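(* Let $n\ge 2$. Consider $\sigma\in S_n$ of order $t$, regarded as an element of $VB_n/\Gamma_2(VP_n)=VP_n/\Gamma_2(VP_n)\rtimes S_n$. Let $\theta=\overline{\pi}_p(\sigma)^{-1}$ and let $T_\theta$ be a transversal of the action of $\sigma$ on $\{\lambda_{i,j}\mid 1\le i\ne j\le n\}$. For integers $a_{i,j}$, the element $\prod_{1\le i\ne j\le n}\lambda_{i,j}^{a_{i,j}}\,\sigma$ has order $t$ in $VB_n/\Gamma_2(VP_n)$ if and only if $$\sum_{\lambda_{i_1,j_1}\in\mathcal{O}_\theta(\lambda_{i,j})}a_{i_1,j_1}=0\quad\text{for all }\lambda_{i,j}\in T_\theta .$$
   Context: Permutations are composed left to right: $\sigma\tau(x)=\tau(\sigma(x))$. $\Gamma_2(H)=[H,H]$. $VB_n$ is the group with generators $\sigma_i,\rho_i$ ($1\le i\le n-1$) and relations: $\sigma_i\sigma_{i+1}\sigma_i=\sigma_{i+1}\sigma_i\sigma_{i+1}$, $\rho_i\rho_{i+1}\rho_i=\rho_{i+1}\rho_i\rho_{i+1}$, $\rho_i\rho_{i+1}\sigma_i=\sigma_{i+1}\rho_i\rho_{i+1}$ for $1\le i\le n-2$; $\rho_i^2=1$; and $\sigma_i\sigma_j=\sigma_j\sigma_i$, $\rho_i\rho_j=\rho_j\rho_i$, $\sigma_i\rho_j=\rho_j\sigma_i$ for $|i-j|\ge 2$. $VP_n$ is the kernel of $\pi_p\colon VB_n\to S_n$, $\sigma_i,\rho_i\mapsto(i,i+1)$, and $\overline{\pi}_p\colon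 VB_n/\Gamma_2(VP_n)\to S_n$ is the induced map; it is split by $(i,i+1)\mapsto\rho_i$, which identifies $S_n$ with the subgroup $\langle\rho_1,\dots,\rho_{n-1}\rangle$. Put $\lambda_{i,i+1}=\rho_i\sigma_i^{-1}$, $\lambda_{i+1,i}=\sigma_i^{-1}\rho_i$, and for $j>i+1$, $\lambda_{i,j}=w\lambda_{i,i+1}w^{-1}$, $\lambda_{j,i}=w\lambda_{i+1,i}w^{-1}$ with $w=\rho_{j-1}\rho_{j-2}\cdots\rho_{i+1}$. It is known that $VP_n/\Gamma_2(VP_n)$ is free Abelian with basis the (classes of the) $\lambda_{i,j}$, $1\le i\neq j\le n$, and that for $\nu\in VB_n/\Gamma_2(VP_n)$ with $\theta=\overline{\pi}_p(\nu)^{-1}$ one has $\nu\lambda_{i,j}\nu^{-1}=\lambda_{\theta(i),\theta(j)}$. The action of $\nu$ on the $\lambda_{i,j}$ is the conjugation action of $\langle\nu\rangle$, $\mathcal{O}_\theta(\lambda_{i,j})=\{\lambda_{\theta^k(i),\theta^k(j)}\mid k\in\mathbb{Z}\}$ is the orbit of $\lambda_{i,j}$, and a transversal is a set with exactly one representative of each orbit. *)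

theory Defs
  imports "HOL-Algebra.Sym_Groups" "HOL-Algebra.Group_Action" "HOL-Algebra.Multiplicative_Group"
begin

section \<open>Groups given by generators and relations\<close>

text \<open>A word is a list of letters: \<open>(x, True)\<close> stands for the generator \<open>x\<close> and \<open>(x, False)\<close> for
  its inverse.  The group with generators \<open>X\<close> and relations \<open>u = v\<close>, \<open>(u, v) \<in> R\<close>, consists of the
  classes of words over \<open>X\<close> modulo the congruence generated by \<open>R\<close> and free cancellation.\<close>

type_synonym 'a word = "('a \<times> bool) list"

abbreviation words :: "'a set \<Rightarrow> 'a word set"
  where "words X \<equiv> lists (X \<times> UNIV)"

inductive_set pres_rel :: "'a set \<Rightarrow> ('a word \<times> 'a word) set \<Rightarrow> ('a word \<times> 'a word) set"
  for X :: "'a set" and R :: "('a word \<times> 'a word) set" where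
  pr_refl: "w \<in> words X \<Longrightarrow> (w, w) \<in> pres_rel X R"
| pr_sym: "(u, v) \<in> pres_rel X R \<Longrightarrow> (v, u) \<in> pres_rel X R"
| pr_trans: "(u, v) \<in> pres_rel X R \<Longrightarrow> (v, w) \<in> pres_rel X R \<Longrightarrow> (u, w) \<in> pres_rel X R"
| pr_cancel: "u \<in> words X \<Longrightarrow> v \<in> words X \<Longrightarrow> x \<in> X \<Longrightarrow>
    (u @ [(x, b), (x, \<not> b)] @ v, u @ v) \<in> pres_rel X R"
| pr_rel: "u \<in> words X \<Longrightarrow> v \<in> words X \<Longrightarrow> (l, r) \<in> R \<Longrightarrow> l \<in> words X \<Longrightarrow> r \<in> words X \<Longrightarrow>
    (u @ l @ v, u @ r @ v) \<in> pres_rel X R"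

definition presented_group :: "'a set \<Rightarrow> ('a word \<times> 'a word) set \<Rightarrow> 'a word set monoid" where
  "presented_group X R =
    \<lparr>carrier = words X // pres_rel X R,
     mult = (\<lambda>A B. \<Union>a\<in>A. \<Union>b\<in>B. pres_rel X R `` {a @ b}),
     one = pres_rel X R `` {[]}\<rparr>"

definition eval_word :: "('g, 'm) monoid_scheme \<Rightarrow> ('a \<Rightarrow> 'g) \<Rightarrow> 'a word \<Rightarrow> 'g" where
  "eval_word G f w =
    foldr (\<lambda>(x, b) g. (if b then f x else inv\<^bsub>G\<^esub> (f x)) \<otimes>\<^bsub>G\<^esub> g) w \<one>\<^bsub>G\<^esub>"

lemma pres_rel_words: "(u, v) \<in> pres_rel X R \<Longrightarrow> u \<in> words X \<and> v \<in> words X"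
  by (induction rule: pres_rel.induct) auto

lemma equiv_pres_rel: "equiv (words X) (pres_rel X R)"
proof (rule equivI)
  show "pres_rel X R \<subseteq> words X \<times> words X" using pres_rel_words by (metis mem_Sigma_iff subrelI)
  show "refl_on (words X) (pres_rel X R)"
    by (auto intro!: refl_onI pr_refl)
  show "sym (pres_rel X R)" by (auto intro: symI pr_sym)
  show "trans (pres_rel X R)" by (auto intro: transI pr_trans)
qed

lemma pres_rel_append_right:
  "(u, v) \<in> pres_rel X R \<Longrightarrow> w \<in> words X \<Longrightarrow> (u @ w, v @ w) \<in> pres_rel X R"
proof (induction rule: pres_rel.induct)
  case (pr_cancel u v x b)
  then show ?case using pres_rel.pr_cancel[of u X "v @ w" x b R] by simp
next
  case (pr_rel u v l r)
  then show ?case using pres_rel.pr_rel[of u X "v @ w" l r R] by simp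
next
  case (pr_refl v)
  then show ?case by (intro pres_rel.pr_refl) simp
qed (blast intro: pr_sym pr_trans)+

lemma pres_rel_append_left:
  "(u, v) \<in> pres_rel X R \<Longrightarrow> w \<in> words X \<Longrightarrow> (w @ u, w @ v) \<in> pres_rel X R"
proof (induction rule: pres_rel.induct)
  case (pr_cancel u v x b)
  then show ?case using pres_rel.pr_cancel[of "w @ u" X "v" x b R] by simp
next
  case (pr_rel u v l r)
  then show ?case using pres_rel.pr_rel[of "w @ u" X "v" l r R] by simp
next
  case (pr_refl v)
  then show ?case by (intro pres_rel.pr_refl) simp
qed (blast intro: pr_sym pr_trans)+

lemma pres_rel_append:
  "(u, v) \<in> pres_rel X R \<Longrightarrow> (u', v') \<in> pres_rel X R \<Longrightarrow> (u @ u', v @ v') \<in> pres_rel X R"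
  by (meson pr_trans pres_rel_append_left pres_rel_append_right pres_rel_words)

lemma presented_mult:
  assumes "u \<in> words X" "v \<in> words X"
  shows "(pres_rel X R `` {u}) \<otimes>\<^bsub>presented_group X R\<^esub> (pres_rel X R `` {v})
    = pres_rel X R `` {u @ v}"
proof -
  have "congruent2 (pres_rel X R) (pres_rel X R) (\<lambda>a b. pres_rel X R `` {a @ b})"
    by (rule congruent2I')
       (use equiv_class_eq[OF equiv_pres_rel] pres_rel_append in blast)
  from UN_equiv_class2[OF equiv_pres_rel equiv_pres_rel this assms]
  show ?thesis by (simp add: presented_group_def)
qed

lemma presented_one: "\<one>\<^bsub>presented_group X R\<^esub> = pres_rel X R `` {[]}"
  by (simp add: presented_group_def)

lemma presented_carrier:
  "A \<in> carrier (presented_group X R) \<longleftrightarrow> (\<exists>w\<in>words X. A = pres_rel X R `` {w})"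
  by (auto simp: presented_group_def quotient_def)

lemma word_inverse:
  assumes "w \<in> words X"
  shows "(rev (map (\<lambda>(x, b). (x, \<not> b)) w) @ w, []) \<in> pres_rel X R"
  using assms
proof (induction w)
  case Nil
  then show ?case by (simp add: pr_refl)
next
  case (Cons a w)
  obtain x b where a: "a = (x, b)" by force
  have x: "x \<in> X" and w: "w \<in> words X" using Cons a by auto
  have u: "rev (map (\<lambda>(x, b). (x, \<not> b)) w) \<in> words X"
    using w by (auto simp: in_lists_conv_set)
  from pr_cancel[OF u w x, of "\<not> b" R] Cons show ?case
    by (auto simp: a intro: pr_trans)
qed

lemma group_presented: "group (presented_group X R)"
proof (rule groupI)
  fix A assume "A \<in> carrier (presented_group X R)"
  then obtain w where w: "w \<in> words X" "A = pres_rel X R `` {w}"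
    by (auto simp: presented_carrier)
  define v where "v = rev (map (\<lambda>(x, b). (x, \<not> b)) w)"
  have v: "v \<in> words X" using w by (auto simp: in_lists_conv_set v_def)
  have "(v @ w, []) \<in> pres_rel X R" unfolding v_def by (rule word_inverse[OF w(1)])
  then show "\<exists>B\<in>carrier (presented_group X R).
      B \<otimes>\<^bsub>presented_group X R\<^esub> A = \<one>\<^bsub>presented_group X R\<^esub>"
    using v w equiv_class_eq[OF equiv_pres_rel]
    by (metis presented_carrier presented_mult presented_one)
next
  show "\<one>\<^bsub>presented_group X R\<^esub> \<in> carrier (presented_group X R)"
    unfolding presented_one presented_carrier by blast
next
  fix A B assume "A \<in> carrier (presented_group X R)" "B \<in> carrier (presented_group X R)"
  then show "A \<otimes>\<^bsub>presented_group X R\<^esub> B \<in> carrier (presented_group X R)"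
    by (metis presented_carrier presented_mult append_in_lists_conv)
next
  fix A B C assume "A \<in> carrier (presented_group X R)" "B \<in> carrier (presented_group X R)"
    "C \<in> carrier (presented_group X R)"
  then obtain u v w where "u \<in> words X" "v \<in> words X" "w \<in> words X"
    "A = pres_rel X R `` {u}" "B = pres_rel X R `` {v}" "C = pres_rel X R `` {w}"
    unfolding presented_carrier by blast
  then show "A \<otimes>\<^bsub>presented_group X R\<^esub> B \<otimes>\<^bsub>presented_group X R\<^esub> C
      = A \<otimes>\<^bsub>presented_group X R\<^esub> (B \<otimes>\<^bsub>presented_group X R\<^esub> C)"
    by (simp add: presented_mult)
next
  fix A assume "A \<in> carrier (presented_group X R)"
  then obtain w where w: "w \<in> words X" "A = pres_rel X R `` {w}"
    by (auto simp: presented_carrier)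
  then show "\<one>\<^bsub>presented_group X R\<^esub> \<otimes>\<^bsub>presented_group X R\<^esub> A = A"
    using presented_mult[of "[]" X w R] by (simp add: presented_one)
qed

context group
begin

lemma eval_word_closed:
  assumes "f \<in> X \<rightarrow> carrier G" "w \<in> words X"
  shows "eval_word G f w \<in> carrier G"
  using assms(2)
proof (induction w)
  case Nil
  then show ?case by (simp add: eval_word_def)
next
  case (Cons a w)
  with assms(1) show ?case by (cases a) (auto simp: eval_word_def)
qed

lemma eval_word_append:
  assumes f: "f \<in> X \<rightarrow> carrier G" and "u \<in> words X" and v: "v \<in> words X"
  shows "eval_word G f (u @ v) = eval_word G f u \<otimes> eval_word G f v"
  using assms(2)
proof (induction u)
  case Nil
  then show ?case using eval_word_closed[OF f v] by (simp add: eval_word_def)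
next
  case (Cons a u)
  obtain x b where a: "a = (x, b)" by force
  have x: "f x \<in> carrier G" and u: "u \<in> words X" using Cons a f by auto
  have "eval_word G f (a # z) = (if b then f x else inv f x) \<otimes> eval_word G f z" for z
    by (simp add: eval_word_def a)
  then show ?case
    using x u Cons.IH eval_word_closed[OF f u] eval_word_closed[OF f v] by (simp add: m_assoc)
qed

lemma eval_word_pres_rel:
  assumes f: "f \<in> X \<rightarrow> carrier G"
    and R: "\<And>l r. (l, r) \<in> R \<Longrightarrow> eval_word G f l = eval_word G f r"
  shows "(u, v) \<in> pres_rel X R \<Longrightarrow> eval_word G f u = eval_word G f v"
proof (induction rule: pres_rel.induct)
  case (pr_cancel u v x b)
  have x: "f x \<in> carrier G" using pr_cancel f by auto
  have w: "[(x, b), (x, \<not> b)] \<in> words X" using pr_cancel by auto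
  have "eval_word G f [(x, b), (x, \<not> b)] = \<one>" using x by (cases b) (simp_all add: eval_word_def)
  then show ?case
    using pr_cancel eval_word_append[OF f] eval_word_closed[OF f] w
    by (metis append_in_lists_conv l_one)
next
  case (pr_rel u v l r)
  then show ?case using R eval_word_append[OF f] by (metis append_in_lists_conv)
qed auto

lemma von_Dyck:
  assumes f: "f \<in> X \<rightarrow> carrier G"
    and R: "\<And>l r. (l, r) \<in> R \<Longrightarrow> eval_word G f l = eval_word G f r"
  shows von_Dyck_class: "w \<in> words X \<Longrightarrow>
      the_elem (eval_word G f ` (pres_rel X R `` {w})) = eval_word G f w"
    and von_Dyck_hom: "(\<lambda>A. the_elem (eval_word G f ` A)) \<in> hom (presented_group X R) G"
proof -
  show *: "the_elem (eval_word G f ` (pres_rel X R `` {w})) = eval_word G f w"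
    if "w \<in> words X" for w
  proof (rule the_elem_image_unique)
    show "pres_rel X R `` {w} \<noteq> {}" using pr_refl[OF that] by blast
  next
    fix v assume "v \<in> pres_rel X R `` {w}"
    then show "eval_word G f v = eval_word G f w"
      using eval_word_pres_rel[OF f R] by (metis ImageE singletonD)
  qed
  show "(\<lambda>A. the_elem (eval_word G f ` A)) \<in> hom (presented_group X R) G"
  proof (rule homI)
    fix A assume "A \<in> carrier (presented_group X R)"
    then show "the_elem (eval_word G f ` A) \<in> carrier G"
      using * eval_word_closed[OF f] unfolding presented_carrier by metis
  next
    fix A B assume "A \<in> carrier (presented_group X R)" "B \<in> carrier (presented_group X R)"
    then obtain u v where uv: "u \<in> words X" "v \<in> words X"
      "A = pres_rel X R `` {u}" "B = pres_rel X R `` {v}"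
      unfolding presented_carrier by blast
    then have "u @ v \<in> words X" by simp
    with uv show "the_elem (eval_word G f ` (A \<otimes>\<^bsub>presented_group X R\<^esub> B))
        = the_elem (eval_word G f ` A) \<otimes> the_elem (eval_word G f ` B)"
      by (simp only: presented_mult * eval_word_append[OF f])
  qed
qed

end

section \<open>The virtual braid group and the virtual pure braid group\<close>

datatype vb_gen = Sigma_gen nat | Rho_gen nat

definition vb_gens :: "nat \<Rightarrow> vb_gen set" where
  "vb_gens n = Sigma_gen ` {1..<n} \<union> Rho_gen ` {1..<n}"

abbreviation s_letter :: "nat \<Rightarrow> vb_gen \<times> bool" where "s_letter i \<equiv> (Sigma_gen i, True)"
abbreviation r_letter :: "nat \<Rightarrow> vb_gen \<times> bool" where "r_letter i \<equiv> (Rho_gen i, True)"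

definition vb_rels :: "nat \<Rightarrow> (vb_gen word \<times> vb_gen word) set" where
  "vb_rels n =
     (\<Union>i\<in>{i. 1 \<le> i \<and> i + 2 \<le> n}.
       {([s_letter i, s_letter (i+1), s_letter i], [s_letter (i+1), s_letter i, s_letter (i+1)]),
        ([r_letter i, r_letter (i+1), r_letter i], [r_letter (i+1), r_letter i, r_letter (i+1)]),
        ([r_letter i, r_letter (i+1), s_letter i], [s_letter (i+1), r_letter i, r_letter (i+1)])})
   \<union> (\<Union>i\<in>{1..<n}. {([r_letter i, r_letter i], [])})
   \<union> (\<Union>(i, j)\<in>{(i, j). i \<in> {1..<n} \<and> j \<in> {1..<n} \<and> (i + 2 \<le> j \<or> j + 2 \<le> i)}.
       {([s_letter i, s_letter j], [s_letter j, s_letter i]),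
        ([r_letter i, r_letter j], [r_letter j, r_letter i]),
        ([s_letter i, r_letter j], [r_letter j, s_letter i])})"

definition VB :: "nat \<Rightarrow> vb_gen word set monoid" where
  "VB n = presented_group (vb_gens n) (vb_rels n)"

definition vb_sigma :: "nat \<Rightarrow> nat \<Rightarrow> vb_gen word set" where
  "vb_sigma n i = pres_rel (vb_gens n) (vb_rels n) `` {[s_letter i]}"

definition vb_rho :: "nat \<Rightarrow> nat \<Rightarrow> vb_gen word set" where
  "vb_rho n i = pres_rel (vb_gens n) (vb_rels n) `` {[r_letter i]}"

text \<open>The library's \<^const>\<open>sym_group\<close> composes permutations from right to left; here they are
  composed from left to right, \<open>(p q)(x) = q (p x)\<close>.\<close>

definition Sym :: "nat \<Rightarrow> (nat \<Rightarrow> nat) monoid" where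
  "Sym n = (sym_group n)\<lparr>mult := (\<lambda>p q. q \<circ> p)\<rparr>"

fun gen_perm :: "vb_gen \<Rightarrow> nat \<Rightarrow> nat" where
  "gen_perm (Sigma_gen i) = transpose i (i + 1)"
| "gen_perm (Rho_gen i) = transpose i (i + 1)"

definition pi_p :: "nat \<Rightarrow> vb_gen word set \<Rightarrow> (nat \<Rightarrow> nat)" where
  "pi_p n A = the_elem (eval_word (Sym n) gen_perm ` A)"

definition VP :: "nat \<Rightarrow> vb_gen word set set" where
  "VP n = kernel (VB n) (Sym n) (pi_p n)"

section \<open>The quotient by the commutator subgroup of the virtual pure braid group\<close>

definition VBQ :: "nat \<Rightarrow> vb_gen word set set monoid" where
  "VBQ n = VB n Mod derived (VB n) (VP n)"

definition VPQ :: "nat \<Rightarrow> vb_gen word set set monoid" where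
  "VPQ n = (VB n)\<lparr>carrier := VP n\<rparr> Mod derived (VB n) (VP n)"

definition to_VBQ :: "nat \<Rightarrow> vb_gen word set \<Rightarrow> vb_gen word set set" where
  "to_VBQ n x = derived (VB n) (VP n) #>\<^bsub>VB n\<^esub> x"

definition pi_bar :: "nat \<Rightarrow> vb_gen word set set \<Rightarrow> (nat \<Rightarrow> nat)" where
  "pi_bar n C = the_elem (pi_p n ` C)"

text \<open>The splitting of \<open>pi_bar n\<close> with \<open>(i, i+1) \<mapsto> \<rho>\<^sub>i\<close>: the restriction of \<open>pi_bar n\<close> to the subgroup
  generated by the classes of \<open>\<rho>\<^sub>1, \<dots>, \<rho>\<^bsub>n-1\<^esub>\<close> is an isomorphism onto \<open>Sym n\<close>, and the splitting
  is its inverse.\<close>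

definition perm_section :: "nat \<Rightarrow> (nat \<Rightarrow> nat) \<Rightarrow> vb_gen word set set" where
  "perm_section n p =
    inv_into (generate (VBQ n) ((\<lambda>i. to_VBQ n (vb_rho n i)) ` {1..<n})) (pi_bar n) p"

section \<open>The elements \<open>\<lambda>\<^bsub>i,j\<^esub>\<close> and their orbits\<close>

definition rho_desc :: "nat \<Rightarrow> nat \<Rightarrow> nat \<Rightarrow> vb_gen word set" where
  "rho_desc n i j = foldr (\<lambda>k g. vb_rho n k \<otimes>\<^bsub>VB n\<^esub> g) (rev [i+1..<j]) \<one>\<^bsub>VB n\<^esub>"

text \<open>For \<open>j = i + 1\<close> the word \<open>w = \<rho>\<^bsub>j-1\<^esub> \<dots> \<rho>\<^bsub>i+1\<^esub>\<close> is empty, so one formula covers both the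
  adjacent and the non-adjacent case.\<close>

definition lam :: "nat \<Rightarrow> nat \<Rightarrow> nat \<Rightarrow> vb_gen word set" where
  "lam n i j =
    (if i < j
     then rho_desc n i j
          \<otimes>\<^bsub>VB n\<^esub> (vb_rho n i \<otimes>\<^bsub>VB n\<^esub> inv\<^bsub>VB n\<^esub> (vb_sigma n i))
          \<otimes>\<^bsub>VB n\<^esub> inv\<^bsub>VB n\<^esub> (rho_desc n i j)
     else rho_desc n j i
          \<otimes>\<^bsub>VB n\<^esub> (inv\<^bsub>VB n\<^esub> (vb_sigma n j) \<otimes>\<^bsub>VB n\<^esub> vb_rho n j)
          \<otimes>\<^bsub>VB n\<^esub> inv\<^bsub>VB n\<^esub> (rho_desc n j i))"

definition lamQ :: "nat \<Rightarrow> nat \<Rightarrow> nat \<Rightarrow> vb_gen word set set" where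
  "lamQ n i j = to_VBQ n (lam n i j)"

definition off_diag :: "nat \<Rightarrow> (nat \<times> nat) set" where
  "off_diag n = {(i, j). i \<in> {1..n} \<and> j \<in> {1..n} \<and> i \<noteq> j}"

definition Lams :: "nat \<Rightarrow> vb_gen word set set set" where
  "Lams n = (\<lambda>(i, j). lamQ n i j) ` off_diag n"

definition lam_orbit :: "nat \<Rightarrow> (nat \<Rightarrow> nat) \<Rightarrow> nat \<Rightarrow> nat \<Rightarrow> vb_gen word set set set" where
  "lam_orbit n \<theta> i j =
    {lamQ n ((\<theta> [^]\<^bsub>Sym n\<^esub> k) i) ((\<theta> [^]\<^bsub>Sym n\<^esub> k) j) | k. k \<in> (UNIV :: int set)}"

definition conj_on_Lams ::
    "nat \<Rightarrow> vb_gen word set set \<Rightarrow> vb_gen word set set \<Rightarrow> vb_gen word set set" where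
  "conj_on_Lams n g = (\<lambda>x\<in>Lams n. g \<otimes>\<^bsub>VBQ n\<^esub> x \<otimes>\<^bsub>VBQ n\<^esub> inv\<^bsub>VBQ n\<^esub> g)"

definition lam_transversal ::
    "nat \<Rightarrow> vb_gen word set set \<Rightarrow> vb_gen word set set set \<Rightarrow> bool" where
  "lam_transversal n \<nu> T \<longleftrightarrow> T \<subseteq> Lams n \<and>
    (\<forall>O' \<in> orbits ((VBQ n)\<lparr>carrier := generate (VBQ n) {\<nu>}\<rparr>) (Lams n) (conj_on_Lams n).
       \<exists>!x. x \<in> T \<inter> O')"

section \<open>Well-definedness\<close>

lemma group_VB: "group (VB n)"
  unfolding VB_def by (rule group_presented)

lemma Sym_simps [simp]:
  "carrier (Sym n) = {p. p permutes {1..n}}" "p \<otimes>\<^bsub>Sym n\<^esub> q = q \<circ> p" "\<one>\<^bsub>Sym n\<^esub> = id"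
  by (simp_all add: Sym_def sym_group_def)

lemma group_Sym: "group (Sym n)"
proof (rule groupI)
  fix p assume "p \<in> carrier (Sym n)"
  then have p: "p permutes {1..n}" by simp
  have "p \<circ> inv_into UNIV p = id" using permutes_inv_o(1)[OF p] .
  then show "\<exists>q\<in>carrier (Sym n). q \<otimes>\<^bsub>Sym n\<^esub> p = \<one>\<^bsub>Sym n\<^esub>"
    using permutes_inv[OF p] by (intro bexI[of _ "inv_into UNIV p"]) auto
qed (auto simp: permutes_compose comp_assoc permutes_id)

lemma gen_perm_closed: "gen_perm \<in> vb_gens n \<rightarrow> carrier (Sym n)"
  by (auto simp: vb_gens_def intro!: permutes_swap_id)

lemma gen_perm_rels:
  assumes "(l, r) \<in> vb_rels n"
  shows "eval_word (Sym n) gen_perm l = eval_word (Sym n) gen_perm r"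
  using assms
  by (auto simp: vb_rels_def eval_word_def transpose_def fun_eq_iff split: if_splits)

lemma pi_p_class:
  "w \<in> words (vb_gens n) \<Longrightarrow>
    pi_p n (pres_rel (vb_gens n) (vb_rels n) `` {w}) = eval_word (Sym n) gen_perm w"
  unfolding pi_p_def
  by (rule group.von_Dyck_class[OF group_Sym gen_perm_closed gen_perm_rels])

lemma pi_p_hom: "group_hom (VB n) (Sym n) (pi_p n)"
  unfolding group_hom_def group_hom_axioms_def pi_p_def VB_def
  using group.von_Dyck_hom[OF group_Sym gen_perm_closed gen_perm_rels] group_presented group_Sym
  by blast

lemma VP_normal: "VP n \<lhd> VB n"
  unfolding VP_def by (rule group_hom.normal_kernel[OF pi_p_hom])

lemma derived_VP_normal: "derived (VB n) (VP n) \<lhd> VB n"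
  by (rule group.derived_is_normal[OF group_VB VP_normal])

lemma group_VBQ: "group (VBQ n)"
  unfolding VBQ_def by (rule normal.factorgroup_is_group[OF derived_VP_normal])

lemma comm_group_VPQ: "comm_group (VPQ n)"
  unfolding VPQ_def
  using group.derived_quot_of_subgroup_is_comm_group[OF group_VB normal_imp_subgroup[OF VP_normal]] .

end

theory Submission
  imports Defs
begin

text \<open>
  The quotient \<open>VBQ n\<close> contains a copy of the semidirect product \<open>ZSym n\<close> of the lattice of
  integer vectors indexed by \<open>off_diag n\<close> with \<open>Sym n\<close>, in which the pair \<open>(a, \<sigma>)\<close> corresponds to
  \<open>\<Prod> \<lambda>\<^bsub>i,j\<^esub>\<^bsup>a i j\<^esup> \<sigma>\<close>.  In the semidirect product the order is an elementary matter.  The \<open>t\<close>-th power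
  of \<open>(a, \<sigma>)\<close> is the vector with entries \<open>\<Sum>m<t. a (\<sigma>\<^bsup>m\<^esup> i) (\<sigma>\<^bsup>m\<^esup> j)\<close>, with trivial permutation part, and
  the order equals \<open>t\<close> exactly when this vector is zero (\<open>ord_ZSym_eq_iff\<close>).  Each entry is a positive rational
  multiple of the sum of \<open>a\<close> over the orbit of \<open>(i, j)\<close> (\<open>period_sum_eq_0_iff\<close>), so one
  representative of each orbit suffices.

  To embed the semidirect product, three facts are needed.  First, the subgroup of \<open>VB n\<close> generated by the
  \<open>\<rho>\<^sub>i\<close> is isomorphic to \<open>Sym n\<close>; this makes the section multiplicative and is the Coxeter presentation
  of the symmetric group, proved by normal forms (\<open>hom_parabolic_trivial_kernel\<close>).  Second, lifted
  permutations permute the \<open>\<lambda>\<^bsub>i,j\<^esub>\<close> by conjugation (\<open>lift_conj_lam\<close>), because every \<open>\<lambda>\<^bsub>i,j\<^esub>\<close> is a conjugate of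
  \<open>\<lambda>\<^bsub>1,2\<^esub>\<close> and the stabiliser of the pair \<open>(1, 2)\<close> commutes with \<open>\<lambda>\<^bsub>1,2\<^esub>\<close>.  These two give the homomorphism
  \<open>ZSym_to_VBQ n\<close>.  Third, this homomorphism is injective (\<open>ZSym_to_VBQ_inj\<close>): the presentation of
  \<open>VB n\<close> yields a homomorphism \<open>VB_model n\<close> to \<open>ZSym n\<close> that sends \<open>\<lambda>\<^bsub>i,j\<^esub>\<close> to a unit vector and \<open>\<rho>\<^sub>i\<close> to a
  transposition.  It maps \<open>VP n\<close> into the lattice, hence kills the commutators, and the induced map on
  \<open>VBQ n\<close> is a left inverse.  In particular the \<open>\<lambda>\<^bsub>i,j\<^esub>\<close> are linearly independent in the quotient.
\<close>


section \<open>The symmetric group inside a group containing lifts of the adjacent transpositions\<close>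

lemma inv_Sym: "p permutes {1..n} \<Longrightarrow> inv\<^bsub>Sym n\<^esub> p = inv_into UNIV p"
  by (rule group.inv_equality[OF group_Sym]) (auto simp: permutes_inv permutes_inv_o)

text \<open>Normal forms are easily seen to be stable under right multiplication by single generators, before
  anything is known about the product of two normal forms; this stability suffices.\<close>

lemma (in group) generate_subset_if_right_closed:
  assumes H: "H \<subseteq> carrier G" and N: "N \<subseteq> carrier G" "\<one> \<in> N"
    and closed: "\<And>y h. y \<in> N \<Longrightarrow> h \<in> H \<Longrightarrow> y \<otimes> h \<in> N \<and> y \<otimes> inv h \<in> N"
  shows "generate G H \<subseteq> N"
proof
  fix x assume x: "x \<in> generate G H"
  then have "\<forall>y\<in>N. y \<otimes> x \<in> N"
  proof (induction rule: generate.induct)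
    case one
    then show ?case using N by auto
  next
    case (eng a b)
    then have "a \<in> carrier G" "b \<in> carrier G" using generate_in_carrier[OF H] by auto
    then show ?case using eng N by (metis m_assoc subsetD)
  qed (use closed in auto)
  with N(2) generate_in_carrier[OF H x] show "x \<in> N" by force
qed

text \<open>A group mapping to \<open>Sym n\<close> whose elements \<open>r i\<close> lie over the adjacent transpositions and satisfy the
  Coxeter relations.  The point of the locale is that the subgroup generated by the \<open>r i\<close> is then
  mapped isomorphically onto \<open>Sym n\<close>.\<close>

locale adjacent_transposition_lift = group_hom G "Sym n" \<phi> for G (structure) and n and \<phi> +
  fixes r :: "nat \<Rightarrow> 'a"
  assumes r_closed: "i \<in> {1..<n} \<Longrightarrow> r i \<in> carrier G"
    and r_involution: "i \<in> {1..<n} \<Longrightarrow> r i \<otimes> r i = \<one>"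
    and r_braid: "1 \<le> i \<Longrightarrow> i + 2 \<le> n \<Longrightarrow> r i \<otimes> r (i+1) \<otimes> r i = r (i+1) \<otimes> r i \<otimes> r (i+1)"
    and r_commute: "i \<in> {1..<n} \<Longrightarrow> j \<in> {1..<n} \<Longrightarrow> i + 2 \<le> j \<Longrightarrow> r i \<otimes> r j = r j \<otimes> r i"
    and hom_r: "i \<in> {1..<n} \<Longrightarrow> \<phi> (r i) = transpose i (i+1)"
begin

lemma inv_r: "i \<in> {1..<n} \<Longrightarrow> inv r i = r i"
  by (simp add: r_closed r_involution G.inv_equality)

definition parabolic :: "nat \<Rightarrow> nat \<Rightarrow> 'a set" where
  "parabolic a b = generate G (r ` {a..<b})"

text \<open>The product \<open>r (m-1) \<cdots> r k\<close>, which lies over a permutation sending \<open>m\<close> to \<open>k\<close>.  For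
  \<open>k \<in> {a..m}\<close> these products represent the right cosets of \<open>parabolic a (m-1)\<close> in
  \<open>parabolic a m\<close>.\<close>

definition desc :: "nat \<Rightarrow> nat \<Rightarrow> 'a" where
  "desc k m = foldr (\<lambda>i g. r i \<otimes> g) (rev [k..<m]) \<one>"

lemma desc_empty [simp]: "m \<le> k \<Longrightarrow> desc k m = \<one>"
  by (simp add: desc_def)

lemma desc_Suc: "k \<le> m \<Longrightarrow> desc k (Suc m) = r m \<otimes> desc k m"
  by (simp add: desc_def)

lemma desc_closed: "1 \<le> k \<Longrightarrow> m \<le> n \<Longrightarrow> desc k m \<in> carrier G"
proof (induction m)
  case (Suc m)
  then show ?case by (cases "k \<le> m") (auto simp: desc_Suc r_closed)
qed auto

lemma desc_split_last: "1 \<le> k \<Longrightarrow> k < m \<Longrightarrow> m \<le> n \<Longrightarrow> desc k m = desc (k+1) m \<otimes> r k"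
proof (induction m)
  case (Suc m)
  show ?case
  proof (cases "k = m")
    case True
    then show ?thesis using Suc.prems by (simp add: desc_Suc r_closed)
  next
    case False
    with Suc have "desc k m = desc (k+1) m \<otimes> r k" by simp
    with False Suc.prems show ?thesis
      by (simp add: desc_Suc G.m_assoc r_closed desc_closed)
  qed
qed auto

lemma desc_commute:
  assumes "1 \<le> k" "m \<le> n" "i \<in> {1..<n}" "m + 1 \<le> i \<or> i + 2 \<le> k"
  shows "desc k m \<otimes> r i = r i \<otimes> desc k m"
  using assms
proof (induction m)
  case (Suc m)
  show ?case
  proof (cases "k \<le> m")
    case True
    have c: "r m \<in> carrier G" "r i \<in> carrier G" "desc k m \<in> carrier G"
      using Suc.prems True by (auto intro: r_closed desc_closed)
    have "r m \<otimes> r i = r i \<otimes> r m"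
      using r_commute[of m i] r_commute[of i m] True Suc.prems by auto
    moreover have "desc k m \<otimes> r i = r i \<otimes> desc k m" using Suc by auto
    ultimately show ?thesis using c True by (metis G.m_assoc desc_Suc)
  qed (use Suc in \<open>simp add: r_closed\<close>)
qed (simp add: r_closed)

text \<open>The letter \<open>r i\<close> moves left through the commuting letters until it reaches \<open>r i \<otimes> r (i-1)\<close>; there
  one braid relation turns it into \<open>r (i-1)\<close>, which commutes with all letters further left.\<close>

lemma desc_shift:
  assumes "1 \<le> k" "k < i" "i < m" "m \<le> n"
  shows "desc k m \<otimes> r i = r (i - 1) \<otimes> desc k m"
  using assms
proof (induction m)
  case (Suc m)
  have c: "r m \<in> carrier G" "r i \<in> carrier G" "r (i-1) \<in> carrier G" "desc k m \<in> carrier G"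
    using Suc.prems by (auto intro!: r_closed desc_closed)
  show ?case
  proof (cases "i = m")
    case False
    have rr: "r m \<otimes> r (i-1) = r (i-1) \<otimes> r m"
      by (rule r_commute[symmetric]) (use Suc.prems False in auto)
    have e: "desc k (Suc m) = r m \<otimes> desc k m" by (rule desc_Suc) (use Suc.prems in simp)
    have "desc k (Suc m) \<otimes> r i = r m \<otimes> (desc k m \<otimes> r i)" using c by (simp only: e G.m_assoc)
    also have "desc k m \<otimes> r i = r (i-1) \<otimes> desc k m" using Suc False by auto
    also have "r m \<otimes> (r (i-1) \<otimes> desc k m) = r m \<otimes> r (i-1) \<otimes> desc k m"
      using c by (simp only: G.m_assoc)
    also have "\<dots> = r (i-1) \<otimes> desc k (Suc m)" using c by (simp only: rr e G.m_assoc)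
    finally show ?thesis .
  next
    case True
    \<comment> \<open>With \<open>l = i - 1 = m - 1\<close> the word starts with \<open>r (l+1) \<otimes> r l\<close>, and \<open>r (l+1)\<close> passes the rest of it.\<close>
    define l where "l = i - 1"
    have il: "i = Suc l" and ml: "m = Suc l" using True Suc.prems by (auto simp: l_def)
    have l: "k \<le> l" "1 \<le> l" "l + 2 \<le> n" using Suc.prems il by auto
    define d where "d = desc k l"
    have cl: "r l \<in> carrier G" "r (l+1) \<in> carrier G" "d \<in> carrier G"
      using l Suc.prems by (auto intro!: r_closed desc_closed simp: d_def)
    have d: "d \<otimes> r (l+1) = r (l+1) \<otimes> d" unfolding d_def by (rule desc_commute) (use l Suc.prems in auto)
    have "desc k (Suc m) = r (l+1) \<otimes> (r l \<otimes> d)" using l by (simp add: ml desc_Suc d_def)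
    then have "desc k (Suc m) \<otimes> r i = r (l+1) \<otimes> r l \<otimes> r (l+1) \<otimes> d"
      using cl d by (simp add: il G.m_assoc)
    also have "\<dots> = r l \<otimes> r (l+1) \<otimes> r l \<otimes> d" using r_braid[OF l(2,3)] by simp
    also have "\<dots> = r (i-1) \<otimes> desc k (Suc m)" using cl l by (simp add: il ml desc_Suc d_def G.m_assoc)
    finally show ?thesis .
  qed
qed auto

lemma parabolic_carrier: "1 \<le> a \<Longrightarrow> b \<le> n \<Longrightarrow> parabolic a b \<subseteq> carrier G"
  unfolding parabolic_def by (rule G.generate_incl) (auto intro: r_closed)

lemma parabolic_subgroup: "1 \<le> a \<Longrightarrow> b \<le> n \<Longrightarrow> subgroup (parabolic a b) G"
  unfolding parabolic_def by (rule G.generate_is_subgroup) (auto intro: r_closed)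

lemma parabolic_mono: "b \<le> c \<Longrightarrow> parabolic a b \<subseteq> parabolic a c"
  unfolding parabolic_def by (rule G.mono_generate) auto

lemma desc_in_parabolic: "a \<le> k \<Longrightarrow> desc k m \<in> parabolic a m"
proof (induction m)
  case (Suc m)
  show ?case
  proof (cases "k \<le> m")
    case True
    have "r m \<in> parabolic a (Suc m)"
      using True Suc.prems by (auto simp: parabolic_def intro!: generate.incl)
    moreover have "desc k m \<in> parabolic a (Suc m)"
      using Suc parabolic_mono[of m "Suc m" a] by auto
    ultimately show ?thesis using True by (simp add: desc_Suc) (simp add: parabolic_def generate.eng)
  qed (simp add: parabolic_def generate.one)
qed (simp add: parabolic_def generate.one)

text \<open>Multiplying \<open>y \<otimes> desc k (m+1)\<close> on the right by \<open>r i\<close> either pushes a letter into \<open>y\<close> (when \<open>i\<close> is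
  neither \<open>k - 1\<close> nor \<open>k\<close>) or lengthens or shortens the descending factor, so products of this shape
  exhaust the subgroup.\<close>

lemma parabolic_normal_form:
  assumes a: "1 \<le> a" "a \<le> m" "m < n" and x: "x \<in> parabolic a (Suc m)"
  obtains y k where "y \<in> parabolic a m" "a \<le> k" "k \<le> Suc m" "x = y \<otimes> desc k (Suc m)"
proof -
  define N where "N = {y \<otimes> desc k (Suc m) | y k. y \<in> parabolic a m \<and> a \<le> k \<and> k \<le> Suc m}"
  have N: "N \<subseteq> carrier G"
    using a parabolic_carrier[of a m] by (auto simp: N_def desc_closed subset_iff)
  have step: "y \<otimes> desc k (Suc m) \<otimes> r i \<in> N"
    if y: "y \<in> parabolic a m" and k: "a \<le> k" "k \<le> Suc m" and i: "a \<le> i" "i \<le> m" for y k i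
  proof -
    have c: "y \<in> carrier G" "r i \<in> carrier G" "desc k (Suc m) \<in> carrier G"
      using y k i a parabolic_carrier[of a m] by (auto intro!: r_closed desc_closed)
    have r_par: "y \<otimes> r j \<in> parabolic a m" if "a \<le> j" "j < m" for j
      using y that unfolding parabolic_def by (auto intro!: generate.eng intro: generate.incl)
    have eq: "y \<otimes> desc k (Suc m) \<otimes> r i = y \<otimes> (desc k (Suc m) \<otimes> r i)" using c by (simp add: G.m_assoc)
    consider "i + 2 \<le> k" | "k = i + 1" | "k = i" | "k < i" by linarith
    then show ?thesis
    proof cases
      case 1
      then have "desc k (Suc m) \<otimes> r i = r i \<otimes> desc k (Suc m)"
        by (intro desc_commute) (use a i in auto)
      then have "y \<otimes> desc k (Suc m) \<otimes> r i = y \<otimes> r i \<otimes> desc k (Suc m)" using c by (simp add: G.m_assoc)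
      moreover have "y \<otimes> r i \<in> parabolic a m" using 1 i k by (intro r_par) auto
      ultimately show ?thesis using k unfolding N_def by blast
    next
      case 2
      then have "desc k (Suc m) \<otimes> r i = desc i (Suc m)" using desc_split_last[of i "Suc m"] a i by simp
      moreover have "i \<le> Suc m" using i by simp
      ultimately show ?thesis using eq y i unfolding N_def by (simp only: mem_Collect_eq) blast
    next
      case 3
      then have "desc k (Suc m) = desc (k+1) (Suc m) \<otimes> r i" using desc_split_last[of k "Suc m"] a i by simp
      then have "desc k (Suc m) \<otimes> r i = desc (k+1) (Suc m)"
        using c r_involution[of i] desc_closed[of "k+1" "Suc m"] a i by (simp add: G.m_assoc)
      then show ?thesis using eq y i k 3 unfolding N_def by (auto intro!: exI[of _ y] exI[of _ "k+1"])
    next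
      case 4
      then have "desc k (Suc m) \<otimes> r i = r (i-1) \<otimes> desc k (Suc m)"
        by (intro desc_shift) (use a i k in auto)
      moreover have ri: "r (i-1) \<in> carrier G" by (rule r_closed) (use 4 a i k in auto)
      ultimately have "y \<otimes> desc k (Suc m) \<otimes> r i = y \<otimes> r (i-1) \<otimes> desc k (Suc m)"
        using c ri by (simp add: G.m_assoc)
      moreover have "y \<otimes> r (i-1) \<in> parabolic a m" using 4 i k by (intro r_par) auto
      ultimately show ?thesis using k unfolding N_def by blast
    qed
  qed
  have "parabolic a (Suc m) \<subseteq> N" unfolding parabolic_def
  proof (rule G.generate_subset_if_right_closed)
    show "r ` {a..<Suc m} \<subseteq> carrier G" using a by (auto intro: r_closed)
    show "\<one> \<in> N" unfolding N_def using a
      by (auto intro!: exI[of _ "\<one>"] exI[of _ "Suc m"] simp: parabolic_def generate.one)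
    fix y h assume "y \<in> N" "h \<in> r ` {a..<Suc m}"
    then show "y \<otimes> h \<in> N \<and> y \<otimes> inv h \<in> N"
      using a step inv_r by (auto simp: N_def)
  qed (rule N)
  with x show ?thesis using that by (auto simp: N_def)
qed

lemma hom_parabolic:
  assumes "1 \<le> a" "b \<le> n" "x \<in> parabolic a b"
  shows "\<phi> x permutes {a..b}"
  using assms(3) unfolding parabolic_def
proof (induction rule: generate.induct)
  case (incl h)
  then show ?case using assms(1,2) by (auto simp: hom_r intro!: permutes_swap_id)
next
  case (inv h)
  then show ?case using assms(1,2) by (auto simp: inv_r hom_r intro!: permutes_swap_id)
next
  case (eng x y)
  then have "x \<in> carrier G" "y \<in> carrier G"
    using parabolic_carrier[OF assms(1,2)] unfolding parabolic_def by auto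
  then show ?case using eng permutes_compose[of "\<phi> x" _ "\<phi> y"] by (simp add: o_def)
qed (use permutes_id[of "{a..b}"] in \<open>simp add: id_def\<close>)

lemma hom_desc: "1 \<le> k \<Longrightarrow> k \<le> m \<Longrightarrow> m \<le> n \<Longrightarrow> \<phi> (desc k m) m = k"
proof (induction m)
  case (Suc m)
  then show ?case
    by (cases "k = Suc m") (auto simp: desc_Suc hom_r r_closed desc_closed)
qed auto

text \<open>In the normal form \<open>y \<otimes> desc k m\<close> the factor \<open>y\<close> fixes the top point \<open>m\<close>, so \<open>k\<close> can be read off as
  the image of \<open>m\<close>.  An element over the identity therefore has trivial descending factor and lies in
  the next smaller subgroup, and induction applies.  This is the hard half of the Coxeter
  presentation of the symmetric group, obtained without counting.\<close>

lemma hom_parabolic_trivial_kernel: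
  assumes "m \<le> n" "x \<in> parabolic 1 m" "\<phi> x = id"
  shows "x = \<one>"
  using assms
proof (induction m arbitrary: x)
  case 0
  then show ?case by (simp add: parabolic_def G.generate_empty)
next
  case (Suc m)
  show ?case
  proof (cases "m = 0")
    case True
    then show ?thesis using Suc.prems by (simp add: parabolic_def G.generate_empty)
  next
    case False
    then obtain y k where y: "y \<in> parabolic 1 m" and k: "1 \<le> k" "k \<le> Suc m"
      and x: "x = y \<otimes> desc k (Suc m)"
      using parabolic_normal_form[of 1 m x] Suc.prems by auto
    have "y \<in> carrier G" "desc k (Suc m) \<in> carrier G"
      using y k Suc.prems parabolic_carrier[of 1 m] by (auto intro!: desc_closed)
    moreover have "\<phi> y (Suc m) = Suc m"
      using hom_parabolic[OF _ _ y] Suc.prems by (simp add: permutes_def)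
    ultimately have "\<phi> x (Suc m) = k" using x k hom_desc[of k "Suc m"] Suc.prems by simp
    then have "k = Suc m" using Suc.prems by simp
    then have "x = y" using x \<open>y \<in> carrier G\<close> by simp
    then show ?thesis using Suc y by simp
  qed
qed

text \<open>Dividing \<open>p\<close> by the permutation under the descending product that sends the top point to the same
  place leaves a permutation fixing the top point.  A general lower end \<open>a\<close> is allowed because
  the stabiliser of \<open>1\<close> and \<open>2\<close> is needed later, with \<open>a = 3\<close>.\<close>

lemma hom_parabolic_surj:
  assumes "1 \<le> a" "b \<le> n" "p permutes {a..b}"
  obtains x where "x \<in> parabolic a b" "\<phi> x = p"
  using assms
proof (induction b arbitrary: p thesis)
  case 0
  then show ?case using 0(1)[of "\<one>"] by (auto simp: parabolic_def generate.one)
next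
  case (Suc b)
  show ?case
  proof (cases "a \<le> b")
    case False
    have "p = id"
    proof
      fix x
      show "p x = id x"
        by (cases "a = Suc b") (use False Suc.prems in \<open>auto simp: permutes_def; metis\<close>)+
    qed
    then show ?thesis using Suc.prems(1)[of "\<one>"] by (auto simp: parabolic_def generate.one)
  next
    case True
    define d where "d = desc (p (Suc b)) (Suc b)"
    have k: "a \<le> p (Suc b)" "p (Suc b) \<le> Suc b"
      using permutes_in_image[OF Suc.prems(4), of "Suc b"] True by auto
    have d: "d \<in> parabolic a (Suc b)" unfolding d_def by (rule desc_in_parabolic) (rule k)
    have dc: "d \<in> carrier G" using d Suc.prems parabolic_carrier[of a "Suc b"] by auto
    have dp: "\<phi> d permutes {a..Suc b}" by (rule hom_parabolic) (use d Suc.prems in auto)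
    define q where "q = inv_into UNIV (\<phi> d) \<circ> p"
    have "q permutes {a..Suc b}" unfolding q_def by (intro permutes_compose permutes_inv dp Suc.prems)
    moreover have "\<phi> d (Suc b) = p (Suc b)" unfolding d_def using hom_desc Suc.prems k by simp
    then have "q (Suc b) = Suc b" using permutes_inverses(2)[OF dp] by (simp add: q_def) metis
    ultimately have "q permutes {a..b}"
      by (auto simp: permutes_def) (metis atLeastAtMost_iff le_SucE)
    then obtain y where y: "y \<in> parabolic a b" "\<phi> y = q" using Suc.IH[of q] Suc.prems by auto
    have yc: "y \<in> parabolic a (Suc b)" "y \<in> carrier G"
      using y parabolic_mono[of b "Suc b" a] parabolic_carrier[of a b] Suc.prems by auto
    have "\<phi> (y \<otimes> d) = p"
      using y yc dc by (simp add: q_def fun_eq_iff permutes_inverses(1)[OF dp])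
    moreover have "y \<otimes> d \<in> parabolic a (Suc b)" using yc d by (simp add: parabolic_def generate.eng)
    ultimately show ?thesis using Suc.prems(1) by blast
  qed
qed

definition lift :: "(nat \<Rightarrow> nat) \<Rightarrow> 'a" where
  "lift = inv_into (parabolic 1 n) \<phi>"

lemma hom_inj_on_parabolic: "inj_on \<phi> (parabolic 1 n)"
proof (rule inj_onI)
  fix x y assume xy: "x \<in> parabolic 1 n" "y \<in> parabolic 1 n" and eq: "\<phi> x = \<phi> y"
  have c: "x \<in> carrier G" "y \<in> carrier G" using xy parabolic_carrier[of 1 n] by auto
  have "x \<otimes> inv y \<in> parabolic 1 n"
    using xy parabolic_subgroup[of 1 n] by (simp add: subgroup_def)
  moreover have "\<phi> (x \<otimes> inv y) = id"
    using c eq H.r_inv[of "\<phi> y"] hom_closed[of y] by (simp del: Sym_simps(1,2) add: hom_mult)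
  ultimately have "x \<otimes> inv y = \<one>" by (intro hom_parabolic_trivial_kernel) auto
  then show "x = y" using c by (metis G.inv_equality G.inv_inv G.inv_closed)
qed

lemma lift_in_parabolic: "p permutes {1..n} \<Longrightarrow> lift p \<in> parabolic 1 n"
  and hom_lift: "p permutes {1..n} \<Longrightarrow> \<phi> (lift p) = p"
  unfolding lift_def
  by (metis hom_parabolic_surj[of 1 n p] order.refl image_eqI inv_into_into,
      metis hom_parabolic_surj[of 1 n p] order.refl image_eqI f_inv_into_f)

lemma lift_closed: "p permutes {1..n} \<Longrightarrow> lift p \<in> carrier G"
  using lift_in_parabolic parabolic_carrier[of 1 n] by auto

lemma lift_unique: "x \<in> parabolic 1 n \<Longrightarrow> \<phi> x = p \<Longrightarrow> lift p = x"
  unfolding lift_def using hom_inj_on_parabolic by auto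

lemma lift_hom: "lift \<in> hom (Sym n) G"
proof (rule homI)
  fix p q assume "p \<in> carrier (Sym n)" "q \<in> carrier (Sym n)"
  then show "lift (p \<otimes>\<^bsub>Sym n\<^esub> q) = lift p \<otimes> lift q"
    using lift_in_parabolic[of p] lift_in_parabolic[of q]
    by (intro lift_unique) (auto simp: hom_lift lift_closed parabolic_def generate.eng)
qed (simp add: lift_closed)

lemma lift_transpose: "i \<in> {1..<n} \<Longrightarrow> lift (transpose i (i+1)) = r i"
  by (rule lift_unique) (auto simp: hom_r parabolic_def intro!: generate.incl)

end


section \<open>The conjugates of the first pure generator by lifted permutations\<close>

lemma VB_class_mult:
  "u \<in> words (vb_gens n) \<Longrightarrow> v \<in> words (vb_gens n) \<Longrightarrow>
    (pres_rel (vb_gens n) (vb_rels n) `` {u}) \<otimes>\<^bsub>VB n\<^esub> (pres_rel (vb_gens n) (vb_rels n) `` {v})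
      = pres_rel (vb_gens n) (vb_rels n) `` {u @ v}"
  unfolding VB_def by (rule presented_mult)

lemma VB_class_one: "\<one>\<^bsub>VB n\<^esub> = pres_rel (vb_gens n) (vb_rels n) `` {[]}"
  unfolding VB_def by (rule presented_one)

lemma VB_class_eq:
  "(u, v) \<in> vb_rels n \<Longrightarrow> u \<in> words (vb_gens n) \<Longrightarrow> v \<in> words (vb_gens n) \<Longrightarrow>
    pres_rel (vb_gens n) (vb_rels n) `` {u} = pres_rel (vb_gens n) (vb_rels n) `` {v}"
  using pr_rel[of "[]" "vb_gens n" "[]" u v "vb_rels n"] equiv_class_eq[OF equiv_pres_rel] by force

lemma gen_in_vb_gens:
  "Sigma_gen i \<in> vb_gens n \<longleftrightarrow> i \<in> {1..<n}" "Rho_gen i \<in> vb_gens n \<longleftrightarrow> i \<in> {1..<n}"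
  by (auto simp: vb_gens_def)

lemma VB_letters:
  "i \<in> {1..<n} \<Longrightarrow> [s_letter i] \<in> words (vb_gens n)"
  "i \<in> {1..<n} \<Longrightarrow> [r_letter i] \<in> words (vb_gens n)"
  by (auto simp: vb_gens_def)

lemma VB_gens_closed:
  assumes "i \<in> {1..<n}"
  shows "vb_sigma n i \<in> carrier (VB n)" "vb_rho n i \<in> carrier (VB n)"
  using VB_letters[OF assms] unfolding VB_def vb_sigma_def vb_rho_def presented_carrier by blast+

lemma pi_p_rho:
  assumes "i \<in> {1..<n}"
  shows "pi_p n (vb_rho n i) = transpose i (i+1)"
  using VB_letters(2)[OF assms] unfolding vb_rho_def by (simp add: pi_p_class eval_word_def)

lemma vb_rho_sigma_braid:
  assumes "1 \<le> i" "i + 2 \<le> n"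
  shows "vb_rho n i \<otimes>\<^bsub>VB n\<^esub> vb_rho n (i+1) \<otimes>\<^bsub>VB n\<^esub> vb_sigma n i
    = vb_sigma n (i+1) \<otimes>\<^bsub>VB n\<^esub> vb_rho n i \<otimes>\<^bsub>VB n\<^esub> vb_rho n (i+1)"
  unfolding vb_sigma_def vb_rho_def using assms
  by (simp add: VB_class_mult gen_in_vb_gens)
     (rule VB_class_eq, use assms in \<open>auto simp: vb_rels_def gen_in_vb_gens\<close>)

lemma vb_sigma_rho_commute:
  assumes "i \<in> {1..<n}" "j \<in> {1..<n}" "i + 2 \<le> j \<or> j + 2 \<le> i"
  shows "vb_sigma n i \<otimes>\<^bsub>VB n\<^esub> vb_rho n j = vb_rho n j \<otimes>\<^bsub>VB n\<^esub> vb_sigma n i"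
  unfolding vb_sigma_def vb_rho_def using assms
  by (simp add: VB_class_mult gen_in_vb_gens)
     (rule VB_class_eq, use assms in \<open>auto simp: vb_rels_def gen_in_vb_gens\<close>)

interpretation VB: adjacent_transposition_lift "VB n" n "pi_p n" "vb_rho n" for n
proof -
  interpret group_hom "VB n" "Sym n" "pi_p n" by (rule pi_p_hom)
  show "adjacent_transposition_lift (VB n) n (pi_p n) (vb_rho n)"
  proof
    fix i assume i: "i \<in> {1..<n}"
    show "vb_rho n i \<in> carrier (VB n)" "pi_p n (vb_rho n i) = transpose i (i+1)"
      using i by (rule VB_gens_closed pi_p_rho)+
    show "vb_rho n i \<otimes>\<^bsub>VB n\<^esub> vb_rho n i = \<one>\<^bsub>VB n\<^esub>"
      unfolding vb_rho_def VB_class_one using i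
      by (simp add: VB_class_mult gen_in_vb_gens)
        (rule VB_class_eq, use i in \<open>auto simp: vb_rels_def gen_in_vb_gens\<close>)
    fix j assume "j \<in> {1..<n}" "i + 2 \<le> j"
    with i show "vb_rho n i \<otimes>\<^bsub>VB n\<^esub> vb_rho n j = vb_rho n j \<otimes>\<^bsub>VB n\<^esub> vb_rho n i"
      unfolding vb_rho_def
      by (simp add: VB_class_mult gen_in_vb_gens)
        (rule VB_class_eq, auto simp: vb_rels_def gen_in_vb_gens)
  next
    fix i assume "1 \<le> i" "i + 2 \<le> n"
    then show "vb_rho n i \<otimes>\<^bsub>VB n\<^esub> vb_rho n (i+1) \<otimes>\<^bsub>VB n\<^esub> vb_rho n i
      = vb_rho n (i+1) \<otimes>\<^bsub>VB n\<^esub> vb_rho n i \<otimes>\<^bsub>VB n\<^esub> vb_rho n (i+1)"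
      unfolding vb_rho_def
      by (simp add: VB_class_mult gen_in_vb_gens)
        (rule VB_class_eq, auto simp: vb_rels_def gen_in_vb_gens)
  qed
qed

text \<open>The conjugating word \<open>w = \<rho>\<^bsub>j-1\<^esub> \<cdots> \<rho>\<^bsub>i+1\<^esub>\<close> enters the argument only through two values of its
  permutation.\<close>

lemma rho_desc_eq_lift:
  assumes "1 \<le> i" "i < j" "j \<le> n"
  obtains p where "p permutes {1..n}" "p i = i" "p j = i + 1" "rho_desc n i j = VB.lift n p"
proof
  define d where "d = VB.desc n (i+1) j"
  have d: "rho_desc n i j = d" by (simp add: d_def rho_desc_def VB.desc_def)
  have par: "d \<in> VB.parabolic n 1 n" "d \<in> VB.parabolic n (i+1) j"
    using VB.desc_in_parabolic[of 1 "i+1" n j] VB.desc_in_parabolic[of "i+1" "i+1" n j]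
      VB.parabolic_mono[of j n n 1] assms by (auto simp: d_def)
  show "pi_p n d permutes {1..n}" by (rule VB.hom_parabolic) (use par in auto)
  have "pi_p n d permutes {i+1..j}" by (rule VB.hom_parabolic) (use assms par in auto)
  then show "pi_p n d i = i" by (simp add: permutes_def)
  show "pi_p n d j = i + 1" unfolding d_def by (rule VB.hom_desc) (use assms in auto)
  show "rho_desc n i j = VB.lift n (pi_p n d)" using VB.lift_unique[OF par(1) refl] d by simp
qed

definition lam_base :: "nat \<Rightarrow> vb_gen word set" where
  "lam_base n = vb_rho n 1 \<otimes>\<^bsub>VB n\<^esub> inv\<^bsub>VB n\<^esub> (vb_sigma n 1)"

text \<open>The conjugate of \<open>\<lambda>\<^bsub>1,2\<^esub>\<close> by a lifted permutation \<open>q\<close> depends only on the points that \<open>q\<close> sends to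
  \<open>1\<close> and \<open>2\<close>.  Characterising \<open>\<lambda>\<^bsub>i,j\<^esub>\<close> as the conjugate with these points equal to \<open>i\<close> and \<open>j\<close> replaces
  the case distinctions in its definition by one formula, from which the permutation action is
  immediate.\<close>

definition is_lam :: "nat \<Rightarrow> vb_gen word set \<Rightarrow> nat \<Rightarrow> nat \<Rightarrow> bool" where
  "is_lam n x i j \<longleftrightarrow> (\<exists>q. q permutes {1..n} \<and> q i = 1 \<and> q j = 2 \<and>
     x = VB.lift n q \<otimes>\<^bsub>VB n\<^esub> lam_base n \<otimes>\<^bsub>VB n\<^esub> inv\<^bsub>VB n\<^esub> (VB.lift n q))"

lemma lam_base_closed: "n \<ge> 2 \<Longrightarrow> lam_base n \<in> carrier (VB n)"
  unfolding lam_base_def by (intro VB.G.m_closed VB.G.inv_closed VB_gens_closed) auto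

lemma is_lam_closed: "n \<ge> 2 \<Longrightarrow> is_lam n x i j \<Longrightarrow> x \<in> carrier (VB n)"
  by (auto simp: is_lam_def lam_base_closed VB.lift_closed)

lemma lift_mult:
  "p permutes {1..n} \<Longrightarrow> q permutes {1..n} \<Longrightarrow>
    VB.lift n (q \<circ> p) = VB.lift n p \<otimes>\<^bsub>VB n\<^esub> VB.lift n q"
  using hom_mult[OF VB.lift_hom, of p n q] by simp

lemma (in group) conj_conj:
  "g \<in> carrier G \<Longrightarrow> h \<in> carrier G \<Longrightarrow> x \<in> carrier G \<Longrightarrow>
    g \<otimes> (h \<otimes> x \<otimes> inv h) \<otimes> inv g = (g \<otimes> h) \<otimes> x \<otimes> inv (g \<otimes> h)"
  by (simp add: inv_mult_group m_assoc)

lemma is_lam_conj: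
  assumes n: "n \<ge> 2" and p: "p permutes {1..n}" and x: "is_lam n x (p i) (p j)"
  shows "is_lam n (VB.lift n p \<otimes>\<^bsub>VB n\<^esub> x \<otimes>\<^bsub>VB n\<^esub> inv\<^bsub>VB n\<^esub> (VB.lift n p)) i j"
proof -
  obtain q where q: "q permutes {1..n}" "q (p i) = 1" "q (p j) = 2"
    "x = VB.lift n q \<otimes>\<^bsub>VB n\<^esub> lam_base n \<otimes>\<^bsub>VB n\<^esub> inv\<^bsub>VB n\<^esub> (VB.lift n q)"
    using x unfolding is_lam_def by blast
  show ?thesis unfolding is_lam_def
    by (rule exI[of _ "q \<circ> p"])
      (use q p n in \<open>simp add: permutes_compose lift_mult group.conj_conj[OF group_VB]
        VB.lift_closed lam_base_closed\<close>)
qed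

lemma (in group) conj_eq_if_commute:
  assumes "g \<in> carrier G" "h \<in> carrier G" "x \<in> carrier G" "h \<otimes> x = x \<otimes> h"
  shows "(g \<otimes> h) \<otimes> x \<otimes> inv (g \<otimes> h) = g \<otimes> x \<otimes> inv g"
proof -
  have "h \<otimes> x \<otimes> inv h = x" using assms by (simp add: m_assoc)
  then show ?thesis using conj_conj[OF assms(1-3)] by simp
qed

lemma (in group) generate_commute:
  assumes H: "H \<subseteq> carrier G" and x: "x \<in> carrier G"
    and comm: "\<And>h. h \<in> H \<Longrightarrow> h \<otimes> x = x \<otimes> h" and g: "g \<in> generate G H"
  shows "g \<otimes> x = x \<otimes> g"
  using g
proof (induction rule: generate.induct)
  case (inv h)
  then have "h \<in> carrier G" using H by auto
  then show ?case using comm[OF inv] x by (metis inv_closed inv_solve_left m_assoc m_closed inv_solve_right)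
next
  case (eng a b)
  then have "a \<in> carrier G" "b \<in> carrier G" using generate_in_carrier[OF H] by auto
  then show ?case using eng x by (metis m_assoc)
qed (use x comm in auto)

text \<open>The stabiliser of \<open>1\<close> and \<open>2\<close> lifts to the subgroup generated by \<open>\<rho>\<^sub>3, \<dots>, \<rho>\<^bsub>n-1\<^esub>\<close>, and each of these
  commutes with \<open>\<rho>\<^sub>1\<close> and \<open>\<sigma>\<^sub>1\<close>.\<close>

lemma lift_commute_lam_base:
  assumes n: "n \<ge> 2" and p: "p permutes {1..n}" "p 1 = 1" "p 2 = 2"
  shows "VB.lift n p \<otimes>\<^bsub>VB n\<^esub> lam_base n = lam_base n \<otimes>\<^bsub>VB n\<^esub> VB.lift n p"
proof -
  have "p permutes {3..n}"
    using p unfolding permutes_def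
    by (metis atLeastAtMost_iff le_antisym not_less_eq_eq numeral_2_eq_2 numeral_3_eq_3 One_nat_def)
  then obtain x where x: "x \<in> VB.parabolic n 3 n" "pi_p n x = p"
    using VB.hom_parabolic_surj[of 3 n n p] by auto
  have "VB.parabolic n 3 n \<subseteq> VB.parabolic n 1 n"
    unfolding VB.parabolic_def by (rule group.mono_generate[OF group_VB]) auto
  then have lift: "VB.lift n p = x" using VB.lift_unique[of x n] x by auto
  show ?thesis unfolding lift
  proof (rule group.generate_commute[OF group_VB])
    show "x \<in> generate (VB n) (vb_rho n ` {3..<n})" using x by (simp add: VB.parabolic_def)
    show "lam_base n \<in> carrier (VB n)" by (rule lam_base_closed[OF n])
    fix h assume "h \<in> vb_rho n ` {3..<n}"
    then obtain k where k: "h = vb_rho n k" "k \<in> {3..<n}" by auto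
    have c: "vb_rho n k \<in> carrier (VB n)" "vb_rho n 1 \<in> carrier (VB n)" "vb_sigma n 1 \<in> carrier (VB n)"
      using k by (auto intro!: VB_gens_closed)
    have "vb_rho n 1 \<otimes>\<^bsub>VB n\<^esub> vb_rho n k = vb_rho n k \<otimes>\<^bsub>VB n\<^esub> vb_rho n 1"
      by (rule VB.r_commute) (use k in auto)
    moreover have "vb_sigma n 1 \<otimes>\<^bsub>VB n\<^esub> vb_rho n k = vb_rho n k \<otimes>\<^bsub>VB n\<^esub> vb_sigma n 1"
      by (rule vb_sigma_rho_commute) (use k in auto)
    then have "vb_rho n k \<otimes>\<^bsub>VB n\<^esub> inv\<^bsub>VB n\<^esub> vb_sigma n 1 = inv\<^bsub>VB n\<^esub> vb_sigma n 1 \<otimes>\<^bsub>VB n\<^esub> vb_rho n k"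
      using c by (metis VB.G.inv_closed VB.G.inv_solve_left VB.G.inv_solve_right VB.G.m_assoc VB.G.m_closed)
    ultimately show "h \<otimes>\<^bsub>VB n\<^esub> lam_base n = lam_base n \<otimes>\<^bsub>VB n\<^esub> h"
      unfolding lam_base_def k using c by (metis VB.G.inv_closed VB.G.m_assoc)
  qed (auto intro!: VB_gens_closed)
qed

lemma is_lam_unique:
  assumes n: "n \<ge> 2" and x: "is_lam n x i j" and y: "is_lam n y i j"
  shows "x = y"
proof -
  obtain q where q: "q permutes {1..n}" "q i = 1" "q j = 2"
    "x = VB.lift n q \<otimes>\<^bsub>VB n\<^esub> lam_base n \<otimes>\<^bsub>VB n\<^esub> inv\<^bsub>VB n\<^esub> (VB.lift n q)"
    using x unfolding is_lam_def by blast
  obtain q' where q': "q' permutes {1..n}" "q' i = 1" "q' j = 2"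
    "y = VB.lift n q' \<otimes>\<^bsub>VB n\<^esub> lam_base n \<otimes>\<^bsub>VB n\<^esub> inv\<^bsub>VB n\<^esub> (VB.lift n q')"
    using y unfolding is_lam_def by blast
  \<comment> \<open>The two conjugators differ by a permutation in the stabiliser of 1 and 2.\<close>
  define p where "p = q' \<circ> inv_into UNIV q"
  have p: "p permutes {1..n}" unfolding p_def by (intro permutes_compose permutes_inv q q')
  have "inv_into UNIV q 1 = i" "inv_into UNIV q 2 = j"
    using permutes_inverses(2)[OF q(1)] q by metis+
  then have p12: "p 1 = 1" "p 2 = 2" using q' by (auto simp: p_def)
  have "q' = p \<circ> q" unfolding p_def using permutes_inverses(2)[OF q(1)] by (simp add: fun_eq_iff)
  then have "VB.lift n q' = VB.lift n q \<otimes>\<^bsub>VB n\<^esub> VB.lift n p" using p q by (simp add: lift_mult)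
  then show ?thesis unfolding q(4) q'(4)
    using group.conj_eq_if_commute[OF group_VB VB.lift_closed[OF q(1)] VB.lift_closed[OF p]
      lam_base_closed[OF n] lift_commute_lam_base[OF n p p12]] by simp
qed

text \<open>Conjugation by \<open>\<rho>\<^sub>i \<rho>\<^bsub>i+1\<^esub>\<close> sends \<open>\<rho>\<^sub>i\<close> to \<open>\<rho>\<^bsub>i+1\<^esub>\<close> by the braid relation and \<open>\<sigma>\<^sub>i\<close> to \<open>\<sigma>\<^bsub>i+1\<^esub>\<close> by the
  mixed relation, hence \<open>\<rho>\<^sub>i \<sigma>\<^sub>i\<^sup>-\<^sup>1\<close> to \<open>\<rho>\<^bsub>i+1\<^esub> \<sigma>\<^bsub>i+1\<^esub>\<^sup>-\<^sup>1\<close>.\<close>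

lemma is_lam_adjacent:
  assumes "n \<ge> 2" "1 \<le> i" "i < n"
  shows "is_lam n (vb_rho n i \<otimes>\<^bsub>VB n\<^esub> inv\<^bsub>VB n\<^esub> (vb_sigma n i)) i (i+1)"
  using assms(2,3)
proof (induction i rule: dec_induct)
  case base
  have "VB.lift n id = \<one>\<^bsub>VB n\<^esub>"
    by (rule VB.lift_unique) (auto simp: VB.parabolic_def generate.one id_def)
  then show ?case unfolding is_lam_def lam_base_def[symmetric]
    using lam_base_closed[OF assms(1)] by (intro exI[of _ id]) (auto simp: permutes_id)
next
  case (step i)
  define p where "p = transpose (i+1) (i+2) \<circ> transpose i (i+1)"
  define R where "R = vb_rho n i"
  define R' where "R' = vb_rho n (i+1)"
  define S where "S = vb_sigma n i"
  define S' where "S' = vb_sigma n (i+1)"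
  have i: "i \<in> {1..<n}" "i + 1 \<in> {1..<n}" "1 \<le> i" "i + 2 \<le> n" using step by auto
  have c: "R \<in> carrier (VB n)" "R' \<in> carrier (VB n)" "S \<in> carrier (VB n)" "S' \<in> carrier (VB n)"
    unfolding R_def R'_def S_def S'_def using i by (auto intro!: VB_gens_closed)
  have p: "p permutes {1..n}" unfolding p_def by (intro permutes_compose permutes_swap_id) (use i in auto)
  have "VB.lift n p = VB.lift n (transpose i (i+1)) \<otimes>\<^bsub>VB n\<^esub> VB.lift n (transpose (i+1) (i+2))"
    unfolding p_def by (intro lift_mult permutes_swap_id) (use i in auto)
  then have lift: "VB.lift n p = R \<otimes>\<^bsub>VB n\<^esub> R'"
    using VB.lift_transpose[OF i(1)] VB.lift_transpose[OF i(2)] by (simp add: R_def R'_def)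
  have "is_lam n (R \<otimes>\<^bsub>VB n\<^esub> inv\<^bsub>VB n\<^esub> S) (p (Suc i)) (p (Suc i + 1))"
    using step by (simp add: p_def R_def S_def transpose_def)
  note conj = is_lam_conj[OF assms(1) p this, unfolded lift]
  have braid: "R \<otimes>\<^bsub>VB n\<^esub> R' \<otimes>\<^bsub>VB n\<^esub> R = R' \<otimes>\<^bsub>VB n\<^esub> R \<otimes>\<^bsub>VB n\<^esub> R'"
    unfolding R_def R'_def using VB.r_braid[OF i(3,4)] .
  have mixed: "R \<otimes>\<^bsub>VB n\<^esub> R' \<otimes>\<^bsub>VB n\<^esub> S = S' \<otimes>\<^bsub>VB n\<^esub> (R \<otimes>\<^bsub>VB n\<^esub> R')"
    using vb_rho_sigma_braid[OF i(3,4)] c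
    by (simp add: R_def R'_def S_def S'_def VB.G.m_assoc)
  define g where "g = R \<otimes>\<^bsub>VB n\<^esub> R'"
  have g: "g \<in> carrier (VB n)" using c by (simp add: g_def)
  have gR: "g \<otimes>\<^bsub>VB n\<^esub> R \<otimes>\<^bsub>VB n\<^esub> inv\<^bsub>VB n\<^esub> g = R'"
    using braid c g by (simp add: g_def VB.G.m_assoc VB.G.inv_solve_right')
  have gS: "g \<otimes>\<^bsub>VB n\<^esub> S \<otimes>\<^bsub>VB n\<^esub> inv\<^bsub>VB n\<^esub> g = S'"
    using mixed c g by (simp add: g_def[symmetric] VB.G.m_assoc VB.G.inv_solve_right')
  have "g \<otimes>\<^bsub>VB n\<^esub> (R \<otimes>\<^bsub>VB n\<^esub> inv\<^bsub>VB n\<^esub> S) \<otimes>\<^bsub>VB n\<^esub> inv\<^bsub>VB n\<^esub> g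
    = (g \<otimes>\<^bsub>VB n\<^esub> R \<otimes>\<^bsub>VB n\<^esub> inv\<^bsub>VB n\<^esub> g) \<otimes>\<^bsub>VB n\<^esub> inv\<^bsub>VB n\<^esub> (g \<otimes>\<^bsub>VB n\<^esub> S \<otimes>\<^bsub>VB n\<^esub> inv\<^bsub>VB n\<^esub> g)"
    using c g by (simp add: VB.G.m_assoc VB.G.inv_mult_group) (simp add: VB.G.m_assoc[symmetric])
  also have "\<dots> = R' \<otimes>\<^bsub>VB n\<^esub> inv\<^bsub>VB n\<^esub> S'" by (simp add: gR gS)
  finally show ?case using conj by (simp add: g_def R'_def S'_def)
qed

text \<open>\<open>\<sigma>\<^sub>i\<^sup>-\<^sup>1 \<rho>\<^sub>i\<close> is the conjugate of \<open>\<rho>\<^sub>i \<sigma>\<^sub>i\<^sup>-\<^sup>1\<close> by \<open>\<rho>\<^sub>i\<close>, because \<open>\<rho>\<^sub>i\<close> is an involution.\<close>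

lemma is_lam_adjacent_swapped:
  assumes "n \<ge> 2" "1 \<le> i" "i < n"
  shows "is_lam n (inv\<^bsub>VB n\<^esub> (vb_sigma n i) \<otimes>\<^bsub>VB n\<^esub> vb_rho n i) (i+1) i"
proof -
  have i: "i \<in> {1..<n}" using assms by auto
  have p: "transpose i (i+1) permutes {1..n}" by (intro permutes_swap_id) (use i in auto)
  have c: "vb_rho n i \<in> carrier (VB n)" "vb_sigma n i \<in> carrier (VB n)" using i by (auto intro!: VB_gens_closed)
  have sq: "vb_rho n i \<otimes>\<^bsub>VB n\<^esub> (vb_rho n i \<otimes>\<^bsub>VB n\<^esub> y) = y" if "y \<in> carrier (VB n)" for y
    using VB.r_involution[OF i] c that by (simp add: VB.G.m_assoc[symmetric])
  have "is_lam n (vb_rho n i \<otimes>\<^bsub>VB n\<^esub> inv\<^bsub>VB n\<^esub> (vb_sigma n i))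
      (transpose i (i+1) (i+1)) (transpose i (i+1) i)"
    using is_lam_adjacent[OF assms] by simp
  from is_lam_conj[OF assms(1) p this] show ?thesis
    using c sq by (simp add: VB.lift_transpose[OF i, simplified] VB.inv_r[OF i] VB.G.m_assoc)
qed

lemma is_lam_lam:
  assumes "n \<ge> 2" "(i, j) \<in> off_diag n"
  shows "is_lam n (lam n i j) i j"
proof (cases "i < j")
  case True
  obtain p where p: "p permutes {1..n}" "p i = i" "p j = i + 1" "rho_desc n i j = VB.lift n p"
    by (rule rho_desc_eq_lift[of i j n]) (use assms True in \<open>auto simp: off_diag_def\<close>)
  show ?thesis
    using is_lam_conj[OF assms(1) p(1), of _ i j] is_lam_adjacent[OF assms(1), of i] True p assms(2)
    by (simp add: lam_def off_diag_def)
next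
  case False
  obtain p where p: "p permutes {1..n}" "p j = j" "p i = j + 1" "rho_desc n j i = VB.lift n p"
    by (rule rho_desc_eq_lift[of j i n]) (use assms False in \<open>auto simp: off_diag_def\<close>)
  show ?thesis
    using is_lam_conj[OF assms(1) p(1), of _ i j] is_lam_adjacent_swapped[OF assms(1), of j] False p assms(2)
    by (simp add: lam_def off_diag_def)
qed

text \<open>The action of the symmetric group on the \<open>\<lambda>\<^bsub>i,j\<^esub>\<close> holds already in \<open>VB n\<close>, before passing to the
  quotient.\<close>

lemma lift_conj_lam:
  assumes "n \<ge> 2" "p permutes {1..n}" "(i, j) \<in> off_diag n"
  shows "VB.lift n p \<otimes>\<^bsub>VB n\<^esub> lam n (p i) (p j) \<otimes>\<^bsub>VB n\<^esub> inv\<^bsub>VB n\<^esub> (VB.lift n p) = lam n i j"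
proof -
  have "(p i, p j) \<in> off_diag n"
    using assms permutes_in_image[OF assms(2)] permutes_inj[OF assms(2)]
    by (auto simp: off_diag_def dest: injD)
  then show ?thesis
    using assms is_lam_unique is_lam_conj is_lam_lam by blast
qed


section \<open>A semidirect product of an integer lattice with the symmetric group\<close>

text \<open>The semidirect product of the lattice of integer vectors indexed by \<open>off_diag n\<close> with \<open>Sym n\<close>.  A
  permutation acts on a vector by precomposition, which matches
  \<open>p \<lambda>\<^bsub>p i, p j\<^esub> p\<^sup>-\<^sup>1 = \<lambda>\<^bsub>i,j\<^esub>\<close> and permutations composed from left to right.  Vectors vanish off
  \<open>off_diag n\<close>, so that equality of vectors as functions is equality of exponents.\<close>

definition ZSym :: "nat \<Rightarrow> ((nat \<Rightarrow> nat \<Rightarrow> int) \<times> (nat \<Rightarrow> nat)) monoid" where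
  "ZSym n =
    \<lparr>carrier = {(v, p). p permutes {1..n} \<and> (\<forall>i j. (i, j) \<notin> off_diag n \<longrightarrow> v i j = 0)},
     mult = (\<lambda>(v, p) (w, q). (\<lambda>i j. v i j + w (p i) (p j), q \<circ> p)),
     one = (\<lambda>i j. 0, id)\<rparr>"

lemma ZSym_simps [simp]:
  "(v, p) \<in> carrier (ZSym n) \<longleftrightarrow>
    p permutes {1..n} \<and> (\<forall>i j. (i, j) \<notin> off_diag n \<longrightarrow> v i j = 0)"
  "(v, p) \<otimes>\<^bsub>ZSym n\<^esub> (w, q) = (\<lambda>i j. v i j + w (p i) (p j), q \<circ> p)"
  "\<one>\<^bsub>ZSym n\<^esub> = (\<lambda>i j. 0, id)"
  by (simp_all add: ZSym_def)

lemma off_diag_permutes: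
  assumes "p permutes {1..n}"
  shows "(p i, p j) \<in> off_diag n \<longleftrightarrow> (i, j) \<in> off_diag n"
  using permutes_in_image[OF assms] permutes_inj[OF assms]
  by (auto simp: off_diag_def inj_eq)

lemma ZSym_l_inv:
  assumes "p permutes {1..n}"
  shows "(\<lambda>i j. - v (inv_into UNIV p i) (inv_into UNIV p j), inv_into UNIV p) \<otimes>\<^bsub>ZSym n\<^esub> (v, p)
    = \<one>\<^bsub>ZSym n\<^esub>"
  using permutes_inv_o(1)[OF assms] by simp

lemma ZSym_inv_closed:
  assumes "(v, p) \<in> carrier (ZSym n)"
  shows "(\<lambda>i j. - v (inv_into UNIV p i) (inv_into UNIV p j), inv_into UNIV p) \<in> carrier (ZSym n)"
  using assms by (simp add: permutes_inv off_diag_permutes)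

lemma group_ZSym: "group (ZSym n)"
proof (rule groupI)
  fix x assume x: "x \<in> carrier (ZSym n)"
  obtain v p where vp: "x = (v, p)" by force
  have c: "(v, p) \<in> carrier (ZSym n)" "p permutes {1..n}" using x vp by auto
  show "\<exists>y\<in>carrier (ZSym n). y \<otimes>\<^bsub>ZSym n\<^esub> x = \<one>\<^bsub>ZSym n\<^esub>"
    unfolding vp using ZSym_inv_closed[OF c(1)] ZSym_l_inv[OF c(2)] by (rule bexI[rotated])
next
  fix x y assume xy: "x \<in> carrier (ZSym n)" "y \<in> carrier (ZSym n)"
  obtain v p w q where "x = (v, p)" "y = (w, q)" by (metis prod.exhaust)
  then show "x \<otimes>\<^bsub>ZSym n\<^esub> y \<in> carrier (ZSym n)"
    using xy permutes_compose[of p _ q] by (simp add: off_diag_permutes)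
next
  fix x y z
  show "x \<otimes>\<^bsub>ZSym n\<^esub> y \<otimes>\<^bsub>ZSym n\<^esub> z = x \<otimes>\<^bsub>ZSym n\<^esub> (y \<otimes>\<^bsub>ZSym n\<^esub> z)"
    by (cases x; cases y; cases z) (simp add: add.assoc comp_assoc)
next
  fix x assume "x \<in> carrier (ZSym n)"
  then show "\<one>\<^bsub>ZSym n\<^esub> \<otimes>\<^bsub>ZSym n\<^esub> x = x" by (cases x) simp
qed (simp add: permutes_id)

lemma ZSym_inv:
  "(v, p) \<in> carrier (ZSym n) \<Longrightarrow> inv\<^bsub>ZSym n\<^esub> (v, p)
    = (\<lambda>i j. - v (inv_into UNIV p i) (inv_into UNIV p j), inv_into UNIV p)"
  by (rule group.inv_equality[OF group_ZSym])
    (use ZSym_l_inv ZSym_inv_closed in \<open>auto simp del: ZSym_simps(2,3)\<close>)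

lemma snd_hom: "group_hom (ZSym n) (Sym n) snd"
  by (intro group_hom.intro group_hom_axioms.intro group_ZSym group_Sym homI) auto

definition unit_vec :: "nat \<Rightarrow> nat \<Rightarrow> nat \<Rightarrow> nat \<Rightarrow> int" where
  "unit_vec i j = (\<lambda>a b. if a = i \<and> b = j then 1 else 0)"

lemma unit_vec_closed: "(i, j) \<in> off_diag n \<Longrightarrow> (unit_vec i j, id) \<in> carrier (ZSym n)"
  by (auto simp: unit_vec_def permutes_id)

text \<open>The image of \<open>\<sigma>\<^sub>i\<close> is forced by \<open>\<sigma>\<^sub>i = \<lambda>\<^bsub>i,i+1\<^esub>\<^sup>-\<^sup>1 \<rho>\<^sub>i\<close> together with \<open>\<lambda>\<^bsub>i,i+1\<^esub>\<close> going to the unit vector and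
  \<open>\<rho>\<^sub>i\<close> to the transposition.\<close>

fun gen_model :: "vb_gen \<Rightarrow> (nat \<Rightarrow> nat \<Rightarrow> int) \<times> (nat \<Rightarrow> nat)" where
  "gen_model (Sigma_gen i) = (\<lambda>a b. - unit_vec i (i+1) a b, transpose i (i+1))"
| "gen_model (Rho_gen i) = (\<lambda>a b. 0, transpose i (i+1))"

definition VB_model :: "nat \<Rightarrow> vb_gen word set \<Rightarrow> (nat \<Rightarrow> nat \<Rightarrow> int) \<times> (nat \<Rightarrow> nat)" where
  "VB_model n A = the_elem (eval_word (ZSym n) gen_model ` A)"

lemma gen_model_closed: "gen_model \<in> vb_gens n \<rightarrow> carrier (ZSym n)"
  by (auto simp: vb_gens_def unit_vec_def off_diag_def intro!: permutes_swap_id)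

lemma unit_vec_transpose:
  "unit_vec i j (transpose k l a) (transpose k l b) = unit_vec (transpose k l i) (transpose k l j) a b"
  unfolding unit_vec_def by (metis transpose_involutory)

text \<open>For the vectors, each side of a relation is a sum of negated unit vectors after moving all
  transpositions from the arguments to the indices, and the two sums have the same terms.  For the
  permutations, the relations of \<open>gen_perm\<close> apply, as the defining relations contain no inverse
  letters.\<close>

lemma gen_model_rels:
  assumes lr: "(l, r) \<in> vb_rels n"
  shows "eval_word (ZSym n) gen_model l = eval_word (ZSym n) gen_model r"
proof (rule prod_eqI)
  have neq: "Suc i \<noteq> i" "Suc (Suc i) \<noteq> i" "i \<noteq> Suc i" "i \<noteq> Suc (Suc i)" for i by auto
  have far: "transpose k (Suc k) i = i" if "Suc (Suc i) \<le> k \<or> Suc (Suc k) \<le> i \<or> Suc k < i" for i k :: nat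
    using that by (auto simp: transpose_def)
  show "fst (eval_word (ZSym n) gen_model l) = fst (eval_word (ZSym n) gen_model r)"
    using lr unfolding vb_rels_def
    by (auto simp: eval_word_def fun_eq_iff unit_vec_transpose neq far transpose_apply_other)
  have snd_eval: "snd (eval_word (ZSym n) gen_model w) = eval_word (Sym n) gen_perm w"
    if "\<forall>(g, b)\<in>set w. b" for w
    using that
  proof (induction w)
    case (Cons a w)
    obtain g b where "a = (g, b)" by force
    with Cons show ?case
      by (cases g; cases "eval_word (ZSym n) gen_model w") (auto simp: eval_word_def)
  qed (simp add: eval_word_def)
  have "\<forall>(g, b)\<in>set l. b" "\<forall>(g, b)\<in>set r. b" using lr unfolding vb_rels_def by auto
  then show "snd (eval_word (ZSym n) gen_model l) = snd (eval_word (ZSym n) gen_model r)"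
    using gen_perm_rels[OF lr] by (simp add: snd_eval)
qed

lemma VB_model_class:
  "w \<in> words (vb_gens n) \<Longrightarrow>
    VB_model n (pres_rel (vb_gens n) (vb_rels n) `` {w}) = eval_word (ZSym n) gen_model w"
  unfolding VB_model_def
  by (rule group.von_Dyck_class[OF group_ZSym gen_model_closed gen_model_rels])

lemma VB_model_hom: "group_hom (VB n) (ZSym n) (VB_model n)"
  unfolding group_hom_def group_hom_axioms_def VB_model_def VB_def
  using group.von_Dyck_hom[OF group_ZSym gen_model_closed gen_model_rels] group_presented group_ZSym
  by blast

interpretation VBM: group_hom "VB n" "ZSym n" "VB_model n" for n
  by (rule VB_model_hom)

lemma (in group_hom) hom_eval_word:
  assumes "f \<in> X \<rightarrow> carrier G" "w \<in> words X"
  shows "h (eval_word G f w) = eval_word H (h \<circ> f) w"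
  using assms(2)
proof (induction w)
  case Nil
  then show ?case by (simp add: eval_word_def)
next
  case (Cons a w)
  obtain x b where a: "a = (x, b)" by force
  have "f x \<in> carrier G" "eval_word G f w \<in> carrier G"
    using Cons.hyps a assms(1) G.eval_word_closed[OF assms(1), of w] by auto
  then show ?case using Cons by (auto simp: a eval_word_def)
qed

lemma snd_VB_model:
  assumes "x \<in> carrier (VB n)"
  shows "snd (VB_model n x) = pi_p n x"
proof -
  obtain w where w: "w \<in> words (vb_gens n)" "x = pres_rel (vb_gens n) (vb_rels n) `` {w}"
    using assms unfolding VB_def presented_carrier by blast
  have "snd \<circ> gen_model = gen_perm"
  proof
    fix g show "(snd \<circ> gen_model) g = gen_perm g" by (cases g) auto
  qed
  then show ?thesis
    using group_hom.hom_eval_word[OF snd_hom gen_model_closed w(1)] w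
    by (simp add: VB_model_class pi_p_class)
qed

lemma VB_model_gens:
  assumes "i \<in> {1..<n}"
  shows "VB_model n (vb_sigma n i) = (\<lambda>a b. - unit_vec i (i+1) a b, transpose i (i+1))"
    "VB_model n (vb_rho n i) = (\<lambda>a b. 0, transpose i (i+1))"
  using VB_letters[OF assms] unfolding vb_sigma_def vb_rho_def
  by (simp_all add: VB_model_class eval_word_def)

lemma VB_model_lift:
  assumes p: "p permutes {1..n}"
  shows "VB_model n (VB.lift n p) = (\<lambda>i j. 0, p)"
proof -
  have "fst (VB_model n x) = (\<lambda>i j. 0)" if "x \<in> VB.parabolic n 1 n" for x
    using that unfolding VB.parabolic_def
  proof (induction rule: generate.induct)
    case (eng x y)
    have c: "x \<in> carrier (VB n)" "y \<in> carrier (VB n)"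
      using eng VB.parabolic_carrier[of 1 n n] unfolding VB.parabolic_def by auto
    show ?case
      using eng by (cases "VB_model n x"; cases "VB_model n y") (simp add: VBM.hom_mult c)
  next
    case (inv h)
    then show ?case by (auto simp: VB.inv_r VB_model_gens)
  qed (auto simp: VB_model_gens)
  then have "fst (VB_model n (VB.lift n p)) = (\<lambda>i j. 0)" using VB.lift_in_parabolic[OF p] by blast
  moreover have "snd (VB_model n (VB.lift n p)) = p"
    using snd_VB_model[OF VB.lift_closed[OF p]] VB.hom_lift[OF p] by simp
  ultimately show ?thesis by (simp add: prod_eq_iff)
qed

lemma VB_model_lam_base:
  assumes "n \<ge> 2"
  shows "VB_model n (lam_base n) = (unit_vec 1 2, id)"
proof -
  have i: "1 \<in> {1..<n}" using assms by auto
  have c: "VB_model n (vb_sigma n 1) \<in> carrier (ZSym n)"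
    by (rule VBM.hom_closed) (rule VB_gens_closed[OF i])
  have "VB_model n (lam_base n) = VB_model n (vb_rho n 1) \<otimes>\<^bsub>ZSym n\<^esub> inv\<^bsub>ZSym n\<^esub> (VB_model n (vb_sigma n 1))"
    unfolding lam_base_def using VB_gens_closed[OF i] by simp
  also have "\<dots> = (unit_vec 1 2, id)"
    using c unfolding VB_model_gens[OF i]
    by (simp add: ZSym_inv del: ZSym_simps(1)) (simp add: unit_vec_def fun_eq_iff numeral_2_eq_2)
  finally show ?thesis .
qed

lemma VB_model_is_lam:
  assumes n: "n \<ge> 2" and x: "is_lam n x i j"
  shows "VB_model n x = (unit_vec i j, id)"
proof -
  obtain q where q: "q permutes {1..n}" "q i = 1" "q j = 2"
    "x = VB.lift n q \<otimes>\<^bsub>VB n\<^esub> lam_base n \<otimes>\<^bsub>VB n\<^esub> inv\<^bsub>VB n\<^esub> (VB.lift n q)"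
    using x unfolding is_lam_def by blast
  have c: "(\<lambda>i j. 0, q) \<in> carrier (ZSym n)" using q by simp
  have "VB_model n x = (\<lambda>i j. 0, q) \<otimes>\<^bsub>ZSym n\<^esub> (unit_vec 1 2, id) \<otimes>\<^bsub>ZSym n\<^esub> inv\<^bsub>ZSym n\<^esub> (\<lambda>i j. 0, q)"
    unfolding q(4) using VB.lift_closed[OF q(1)] lam_base_closed[OF n]
    by (simp add: VB_model_lift[OF q(1)] VB_model_lam_base[OF n])
  also have "\<dots> = (\<lambda>a b. unit_vec 1 2 (q a) (q b), id)"
    using ZSym_inv[OF c] permutes_inv_o(2)[OF q(1)] by simp
  also have "(\<lambda>a b. unit_vec 1 2 (q a) (q b)) = unit_vec i j"
    unfolding unit_vec_def q(2,3)[symmetric] by (simp add: inj_eq[OF permutes_inj[OF q(1)]])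
  finally show ?thesis .
qed

text \<open>Elements of \<open>VP n\<close> lie over the identity permutation, so they are mapped into the lattice, which is
  commutative.\<close>

lemma derived_VP_subset_kernel_model: "derived (VB n) (VP n) \<subseteq> kernel (VB n) (ZSym n) (VB_model n)"
  unfolding derived_def
proof (rule group.generate_subgroup_incl[OF group_VB _ VBM.subgroup_kernel], rule subsetI)
  fix z assume "z \<in> derived_set (VB n) (VP n)"
  then obtain x y where xy: "x \<in> VP n" "y \<in> VP n" and
    z: "z = x \<otimes>\<^bsub>VB n\<^esub> y \<otimes>\<^bsub>VB n\<^esub> inv\<^bsub>VB n\<^esub> x \<otimes>\<^bsub>VB n\<^esub> inv\<^bsub>VB n\<^esub> y" by blast
  have c: "x \<in> carrier (VB n)" "y \<in> carrier (VB n)" and "pi_p n x = id" "pi_p n y = id"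
    using xy by (auto simp: VP_def kernel_def)
  then obtain v w where vw: "VB_model n x = (v, id)" "VB_model n y = (w, id)"
    using snd_VB_model by (metis prod.collapse)
  then have "(v, id) \<in> carrier (ZSym n)" "(w, id) \<in> carrier (ZSym n)" using c VBM.hom_closed by metis+
  then have "VB_model n z = \<one>\<^bsub>ZSym n\<^esub>"
    using c by (simp add: z vw ZSym_inv del: ZSym_simps(1)) 
  then show "z \<in> kernel (VB n) (ZSym n) (VB_model n)" using c by (simp add: kernel_def z)
qed

text \<open>The homomorphism that detects exponents in the quotient: it will show that the \<open>\<lambda>\<^bsub>i,j\<^esub>\<close> are linearly
  independent there.\<close>

lemma VBQ_model_ex:
  "\<exists>\<Phi>. \<Phi> \<in> hom (VBQ n) (ZSym n) \<and> (\<forall>x\<in>carrier (VB n). \<Phi> (to_VBQ n x) = VB_model n x)"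
  using VBM.FactGroup_universal_kernel[OF derived_VP_normal derived_VP_subset_kernel_model]
  unfolding VBQ_def to_VBQ_def by metis


section \<open>The semidirect product inside the quotient\<close>

lemma to_VBQ_hom: "group_hom (VB n) (VBQ n) (to_VBQ n)"
  using normal.r_coset_hom_Mod[OF derived_VP_normal]
  by (intro group_hom.intro group_hom_axioms.intro group_VB group_VBQ)
    (simp add: VBQ_def to_VBQ_def [abs_def])

interpretation to_VBQ: group_hom "VB n" "VBQ n" "to_VBQ n" for n
  by (rule to_VBQ_hom)

lemma VP_subgroup: "subgroup (VP n) (VB n)"
  by (rule normal_imp_subgroup[OF VP_normal])

lemma derived_VP_subset: "derived (VB n) (VP n) \<subseteq> VP n"
  by (rule group.derived_incl[OF group_VB order.refl VP_subgroup])

lemma pi_bar_to_VBQ: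
  assumes x: "x \<in> carrier (VB n)"
  shows "pi_bar n (to_VBQ n x) = pi_p n x"
  unfolding pi_bar_def
proof (rule the_elem_image_unique)
  show "to_VBQ n x \<noteq> {}"
    using x subgroup.one_closed[OF normal_imp_subgroup[OF derived_VP_normal]]
    by (auto simp: to_VBQ_def r_coset_def)
  fix y assume "y \<in> to_VBQ n x"
  then obtain d where d: "d \<in> derived (VB n) (VP n)" "y = d \<otimes>\<^bsub>VB n\<^esub> x"
    by (auto simp: to_VBQ_def r_coset_def)
  then have "d \<in> carrier (VB n)" "pi_p n d = \<one>\<^bsub>Sym n\<^esub>"
    using derived_VP_subset[of n] by (auto simp: VP_def kernel_def)
  then show "pi_p n y = pi_p n x" using x d by (simp add: VB.hom_mult)
qed

text \<open>Choosing a preimage in the generated subgroup is unambiguous because the lifted permutations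
  already form a copy of \<open>Sym n\<close> in \<open>VB n\<close> on which \<open>pi_p n\<close> is injective.\<close>

lemma perm_section_eq:
  assumes p: "p permutes {1..n}"
  shows "perm_section n p = to_VBQ n (VB.lift n p)"
proof -
  have "(\<lambda>i. to_VBQ n (vb_rho n i)) ` {1..<n} = to_VBQ n ` vb_rho n ` {1..<n}" by auto
  also have "generate (VBQ n) \<dots> = to_VBQ n ` VB.parabolic n 1 n"
    unfolding VB.parabolic_def by (rule to_VBQ.generate_img) (auto intro!: VB_gens_closed)
  finally have S: "generate (VBQ n) ((\<lambda>i. to_VBQ n (vb_rho n i)) ` {1..<n}) = to_VBQ n ` VB.parabolic n 1 n" .
  have pi: "pi_bar n (to_VBQ n x) = pi_p n x" if "x \<in> VB.parabolic n 1 n" for x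
    using pi_bar_to_VBQ that VB.parabolic_carrier[of 1 n n] by auto
  have "inj_on (pi_bar n) (to_VBQ n ` VB.parabolic n 1 n)"
    using VB.hom_inj_on_parabolic[of n] by (auto simp: inj_on_def pi)
  then show ?thesis unfolding perm_section_def S
    by (rule inv_into_f_eq) (use VB.lift_in_parabolic[OF p] VB.hom_lift[OF p] pi in auto)
qed

lemma pi_bar_perm_section:
  "p permutes {1..n} \<Longrightarrow> pi_bar n (perm_section n p) = p"
  by (simp add: perm_section_eq pi_bar_to_VBQ VB.lift_closed VB.hom_lift)

text \<open>A coset of the commutator subgroup by an element of \<open>VP n\<close> is the same set whether formed in \<open>VP n\<close> or
  in \<open>VB n\<close>, so \<open>VPQ n\<close> is literally a subgroup of \<open>VBQ n\<close>.\<close>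

lemma VPQ_eq: "VPQ n = (VBQ n)\<lparr>carrier := to_VBQ n ` VP n\<rparr>"
  by (auto simp: VPQ_def VBQ_def FactGroup_def RCOSETS_def r_coset_def to_VBQ_def set_mult_def [abs_def])

lemma VPQ_subgroup: "subgroup (carrier (VPQ n)) (VBQ n)"
  using to_VBQ.subgroup_img_is_subgroup[OF VP_subgroup] by (simp add: VPQ_eq)

lemma VPQ_simps:
  "carrier (VPQ n) = to_VBQ n ` VP n" "x \<otimes>\<^bsub>VPQ n\<^esub> y = x \<otimes>\<^bsub>VBQ n\<^esub> y" "\<one>\<^bsub>VPQ n\<^esub> = \<one>\<^bsub>VBQ n\<^esub>"
  by (simp_all add: VPQ_eq)

lemma VPQ_int_pow:
  assumes "x \<in> carrier (VPQ n)"
  shows "x [^]\<^bsub>VPQ n\<^esub> (k::int) = x [^]\<^bsub>VBQ n\<^esub> k"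
  using group.int_pow_consistent[OF group_VBQ VPQ_subgroup assms] by (simp add: VPQ_eq)

interpretation VPQ: comm_group "VPQ n" for n
  by (rule comm_group_VPQ)

lemma lam_in_VP:
  assumes "n \<ge> 2" "(i, j) \<in> off_diag n"
  shows "lam n i j \<in> VP n"
  using is_lam_closed[OF assms(1) is_lam_lam[OF assms]] VB_model_is_lam[OF assms(1) is_lam_lam[OF assms]]
    snd_VB_model[of "lam n i j" n]
  by (simp add: VP_def kernel_def)

lemma lamQ_closed: "n \<ge> 2 \<Longrightarrow> (i, j) \<in> off_diag n \<Longrightarrow> lamQ n i j \<in> carrier (VPQ n)"
  by (simp add: VPQ_simps lamQ_def lam_in_VP)

lemma finite_off_diag: "finite (off_diag n)"
  by (rule finite_subset[of _ "{1..n} \<times> {1..n}"]) (auto simp: off_diag_def)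

definition lam_prod :: "nat \<Rightarrow> (nat \<Rightarrow> nat \<Rightarrow> int) \<Rightarrow> vb_gen word set set" where
  "lam_prod n e = (\<Otimes>\<^bsub>VPQ n\<^esub>p\<in>off_diag n. lamQ n (fst p) (snd p) [^]\<^bsub>VPQ n\<^esub> e (fst p) (snd p))"

lemma lam_pow_closed:
  "n \<ge> 2 \<Longrightarrow> x \<in> off_diag n \<Longrightarrow> lamQ n (fst x) (snd x) [^]\<^bsub>VPQ n\<^esub> (k::int) \<in> carrier (VPQ n)"
  by (simp add: lamQ_closed)

lemma lam_prod_closed: "n \<ge> 2 \<Longrightarrow> lam_prod n e \<in> carrier (VPQ n)"
  unfolding lam_prod_def by (rule VPQ.finprod_closed) (auto intro: lam_pow_closed)

lemma lam_prod_add: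
  assumes n: "n \<ge> 2"
  shows "lam_prod n (\<lambda>i j. e i j + f i j) = lam_prod n e \<otimes>\<^bsub>VBQ n\<^esub> lam_prod n f"
proof -
  have "lam_prod n (\<lambda>i j. e i j + f i j) = (\<Otimes>\<^bsub>VPQ n\<^esub>p\<in>off_diag n.
      lamQ n (fst p) (snd p) [^]\<^bsub>VPQ n\<^esub> e (fst p) (snd p) \<otimes>\<^bsub>VPQ n\<^esub>
      lamQ n (fst p) (snd p) [^]\<^bsub>VPQ n\<^esub> f (fst p) (snd p))"
    unfolding lam_prod_def
    by (rule VPQ.finprod_cong') (auto simp: VPQ.int_pow_mult lamQ_closed[OF n])
  also have "\<dots> = lam_prod n e \<otimes>\<^bsub>VPQ n\<^esub> lam_prod n f"
    unfolding lam_prod_def by (rule VPQ.finprod_multf) (auto simp: lamQ_closed[OF n])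
  finally show ?thesis by (simp add: VPQ_simps)
qed

lemma hom_finprod_comm_group:
  assumes "comm_group G" "comm_group H" "h \<in> hom G H" "finite A" "f \<in> A \<rightarrow> carrier G"
  shows "h (finprod G f A) = finprod H (\<lambda>x. h (f x)) A"
proof -
  interpret G: comm_group G by fact
  interpret H: comm_group H by fact
  interpret h: group_hom G H h
    using assms by (intro group_hom.intro group_hom_axioms.intro G.group_axioms H.group_axioms)
  from assms(4,5) show ?thesis
  proof (induction A rule: finite_induct)
    case (insert x A)
    then have c: "f \<in> A \<rightarrow> carrier G" "f x \<in> carrier G" by auto
    then have "(\<lambda>x. h (f x)) \<in> A \<rightarrow> carrier H" "h (f x) \<in> carrier H"
      by (auto intro: h.hom_closed)
    then show ?case using insert.hyps insert.IH[OF c(1)] c by simp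
  qed simp
qed

lemma VPQ_conj_hom:
  assumes g: "g \<in> carrier (VB n)"
  shows "(\<lambda>x. to_VBQ n g \<otimes>\<^bsub>VBQ n\<^esub> x \<otimes>\<^bsub>VBQ n\<^esub> inv\<^bsub>VBQ n\<^esub> (to_VBQ n g)) \<in> hom (VPQ n) (VPQ n)"
proof (rule homI)
  let ?q = "to_VBQ n"
  fix x assume "x \<in> carrier (VPQ n)"
  then obtain y where y: "y \<in> VP n" "x = ?q y" by (auto simp: VPQ_simps)
  have yc: "y \<in> carrier (VB n)" using y subgroup.subset[OF VP_subgroup] by auto
  have "g \<otimes>\<^bsub>VB n\<^esub> y \<otimes>\<^bsub>VB n\<^esub> inv\<^bsub>VB n\<^esub> g \<in> VP n"
    using normal.inv_op_closed2[OF VP_normal g y(1)] .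
  then have "?q (g \<otimes>\<^bsub>VB n\<^esub> y \<otimes>\<^bsub>VB n\<^esub> inv\<^bsub>VB n\<^esub> g) \<in> carrier (VPQ n)" by (simp add: VPQ_simps)
  then show "?q g \<otimes>\<^bsub>VBQ n\<^esub> x \<otimes>\<^bsub>VBQ n\<^esub> inv\<^bsub>VBQ n\<^esub> (?q g) \<in> carrier (VPQ n)"
    using g yc by (simp add: y)
next
  let ?q = "to_VBQ n"
  have c: "?q g \<in> carrier (VBQ n)" using g by simp
  fix x y assume "x \<in> carrier (VPQ n)" "y \<in> carrier (VPQ n)"
  then have xy: "x \<in> carrier (VBQ n)" "y \<in> carrier (VBQ n)"
    using subgroup.subset[OF VPQ_subgroup] by auto
  have cancel: "inv\<^bsub>VBQ n\<^esub> (?q g) \<otimes>\<^bsub>VBQ n\<^esub> (?q g \<otimes>\<^bsub>VBQ n\<^esub> z) = z" if "z \<in> carrier (VBQ n)" for z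
    using that c by (simp add: to_VBQ.H.m_assoc[symmetric] to_VBQ.H.l_inv)
  show "?q g \<otimes>\<^bsub>VBQ n\<^esub> (x \<otimes>\<^bsub>VPQ n\<^esub> y) \<otimes>\<^bsub>VBQ n\<^esub> inv\<^bsub>VBQ n\<^esub> (?q g)
    = (?q g \<otimes>\<^bsub>VBQ n\<^esub> x \<otimes>\<^bsub>VBQ n\<^esub> inv\<^bsub>VBQ n\<^esub> (?q g)) \<otimes>\<^bsub>VPQ n\<^esub>
      (?q g \<otimes>\<^bsub>VBQ n\<^esub> y \<otimes>\<^bsub>VBQ n\<^esub> inv\<^bsub>VBQ n\<^esub> (?q g))"
    unfolding VPQ_simps using xy c cancel by (simp add: to_VBQ.H.m_assoc)
qed

lemma perm_section_conj_lamQ: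
  assumes n: "n \<ge> 2" and p: "p permutes {1..n}" and ij: "(i, j) \<in> off_diag n"
  shows "perm_section n p \<otimes>\<^bsub>VBQ n\<^esub> lamQ n (p i) (p j) \<otimes>\<^bsub>VBQ n\<^esub> inv\<^bsub>VBQ n\<^esub> (perm_section n p)
    = lamQ n i j"
proof -
  have "(p i, p j) \<in> off_diag n" using off_diag_permutes[OF p] ij by simp
  then have c: "lam n (p i) (p j) \<in> carrier (VB n)"
    using is_lam_closed is_lam_lam n by blast
  have "lamQ n i j = to_VBQ n (VB.lift n p \<otimes>\<^bsub>VB n\<^esub> lam n (p i) (p j) \<otimes>\<^bsub>VB n\<^esub> inv\<^bsub>VB n\<^esub> (VB.lift n p))"
    unfolding lamQ_def lift_conj_lam[OF n p ij] ..
  then show ?thesis using c VB.lift_closed[OF p] by (simp add: perm_section_eq[OF p] lamQ_def)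
qed

text \<open>Conjugation permutes the \<open>\<lambda>\<^bsub>i,j\<^esub>\<close>, and in the commutative group \<open>VPQ n\<close> the product may be reindexed by
  this permutation.\<close>

lemma perm_section_conj_lam_prod:
  assumes n: "n \<ge> 2" and p: "p permutes {1..n}"
  shows "perm_section n p \<otimes>\<^bsub>VBQ n\<^esub> lam_prod n e \<otimes>\<^bsub>VBQ n\<^esub> inv\<^bsub>VBQ n\<^esub> (perm_section n p)
    = lam_prod n (\<lambda>i j. e (p i) (p j))"
proof -
  define c where "c x = perm_section n p \<otimes>\<^bsub>VBQ n\<^esub> x \<otimes>\<^bsub>VBQ n\<^esub> inv\<^bsub>VBQ n\<^esub> (perm_section n p)" for x
  have c: "c \<in> hom (VPQ n) (VPQ n)"
    using VPQ_conj_hom[OF VB.lift_closed[OF p]] by (simp add: c_def[abs_def] perm_section_eq[OF p])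
  define P where "P x = (p (fst x), p (snd x))" for x
  have inj: "inj_on P (off_diag n)"
    by (rule inj_onI) (auto simp: P_def prod_eq_iff inj_eq[OF permutes_inj[OF p]])
  have "P ` off_diag n \<subseteq> off_diag n" by (auto simp: P_def off_diag_permutes[OF p])
  then have P: "P ` off_diag n = off_diag n" using finite_off_diag inj by (simp add: endo_inj_surj)
  have Pc: "P x \<in> off_diag n" if "x \<in> off_diag n" for x using that P by blast
  have "lam_prod n e = (\<Otimes>\<^bsub>VPQ n\<^esub>x\<in>P ` off_diag n. lamQ n (fst x) (snd x) [^]\<^bsub>VPQ n\<^esub> e (fst x) (snd x))"
    unfolding P lam_prod_def ..
  also have "\<dots> = (\<Otimes>\<^bsub>VPQ n\<^esub>x\<in>off_diag n.
      lamQ n (fst (P x)) (snd (P x)) [^]\<^bsub>VPQ n\<^esub> e (fst (P x)) (snd (P x)))"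
    by (rule VPQ.finprod_reindex[OF _ inj]) (unfold P, auto intro: lam_pow_closed[OF n])
  also have "c \<dots> = (\<Otimes>\<^bsub>VPQ n\<^esub>x\<in>off_diag n.
      c (lamQ n (fst (P x)) (snd (P x)) [^]\<^bsub>VPQ n\<^esub> e (fst (P x)) (snd (P x))))"
    by (rule hom_finprod_comm_group[OF comm_group_VPQ comm_group_VPQ c finite_off_diag])
      (use Pc lam_pow_closed[OF n] in blast)
  also have "\<dots> = lam_prod n (\<lambda>i j. e (p i) (p j))" unfolding lam_prod_def
  proof (rule VPQ.finprod_cong'[OF refl])
    fix x assume x: "x \<in> off_diag n"
    then have "c (lamQ n (fst (P x)) (snd (P x))) = lamQ n (fst x) (snd x)"
      using perm_section_conj_lamQ[OF n p, of "fst x" "snd x"] by (simp add: P_def c_def)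
    then show "c (lamQ n (fst (P x)) (snd (P x)) [^]\<^bsub>VPQ n\<^esub> e (fst (P x)) (snd (P x)))
      = lamQ n (fst x) (snd x) [^]\<^bsub>VPQ n\<^esub> e (p (fst x)) (p (snd x))"
      using hom_int_pow[OF c _ VPQ.group_axioms VPQ.group_axioms] lamQ_closed[OF n, of "fst (P x)" "snd (P x)"] Pc[OF x]
      by (simp add: P_def)
  qed (use lam_pow_closed[OF n] in auto)
  finally show ?thesis by (simp add: c_def)
qed

text \<open>The embedding of the semidirect product.  It sends the pair of the exponents \<open>a\<close> and \<open>\<sigma>\<close> to the
  element whose order is in question.\<close>

definition ZSym_to_VBQ :: "nat \<Rightarrow> (nat \<Rightarrow> nat \<Rightarrow> int) \<times> (nat \<Rightarrow> nat) \<Rightarrow> vb_gen word set set" where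
  "ZSym_to_VBQ n x = lam_prod n (fst x) \<otimes>\<^bsub>VBQ n\<^esub> perm_section n (snd x)"

lemma perm_section_closed: "p permutes {1..n} \<Longrightarrow> perm_section n p \<in> carrier (VBQ n)"
  by (simp add: perm_section_eq VB.lift_closed)

lemma lam_prod_closed_VBQ: "n \<ge> 2 \<Longrightarrow> lam_prod n e \<in> carrier (VBQ n)"
  using lam_prod_closed subgroup.subset[OF VPQ_subgroup] by blast

lemma perm_section_mult:
  "p permutes {1..n} \<Longrightarrow> q permutes {1..n} \<Longrightarrow>
    perm_section n (q \<circ> p) = perm_section n p \<otimes>\<^bsub>VBQ n\<^esub> perm_section n q"
  by (simp add: perm_section_eq permutes_compose lift_mult VB.lift_closed)

lemma ZSym_to_VBQ_hom:
  assumes n: "n \<ge> 2"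
  shows "ZSym_to_VBQ n \<in> hom (ZSym n) (VBQ n)"
proof (rule homI)
  fix x assume "x \<in> carrier (ZSym n)"
  then show "ZSym_to_VBQ n x \<in> carrier (VBQ n)"
    by (cases x) (simp add: ZSym_to_VBQ_def perm_section_closed lam_prod_closed_VBQ[OF n])
next
  fix x y assume "x \<in> carrier (ZSym n)" "y \<in> carrier (ZSym n)"
  moreover obtain e p f q where xy: "x = (e, p)" "y = (f, q)" by (metis prod.exhaust)
  ultimately have pq: "p permutes {1..n}" "q permutes {1..n}" by auto
  note c = perm_section_closed[OF pq(1)] perm_section_closed[OF pq(2)] lam_prod_closed_VBQ[OF n]
  have "perm_section n p \<otimes>\<^bsub>VBQ n\<^esub> lam_prod n f
      = lam_prod n (\<lambda>i j. f (p i) (p j)) \<otimes>\<^bsub>VBQ n\<^esub> perm_section n p"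
    unfolding perm_section_conj_lam_prod[OF n pq(1), symmetric]
    using c by (simp add: to_VBQ.H.m_assoc)
  then have "perm_section n p \<otimes>\<^bsub>VBQ n\<^esub> (lam_prod n f \<otimes>\<^bsub>VBQ n\<^esub> perm_section n q)
      = lam_prod n (\<lambda>i j. f (p i) (p j)) \<otimes>\<^bsub>VBQ n\<^esub> (perm_section n p \<otimes>\<^bsub>VBQ n\<^esub> perm_section n q)"
    using c by (metis to_VBQ.H.m_assoc)
  then show "ZSym_to_VBQ n (x \<otimes>\<^bsub>ZSym n\<^esub> y) = ZSym_to_VBQ n x \<otimes>\<^bsub>VBQ n\<^esub> ZSym_to_VBQ n y"
    using c by (simp add: ZSym_to_VBQ_def xy lam_prod_add[OF n] perm_section_mult[OF pq] to_VBQ.H.m_assoc)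
qed

lemma ZSym_int_pow:
  assumes "(v, id) \<in> carrier (ZSym n)"
  shows "(v, id) [^]\<^bsub>ZSym n\<^esub> (k::int) = (\<lambda>i j. k * v i j, id)"
proof -
  have nat: "(v, id) [^]\<^bsub>ZSym n\<^esub> (m::nat) = (\<lambda>i j. int m * v i j, id)" for m
    by (induction m) (auto simp: algebra_simps)
  have c: "(\<lambda>i j. int m * v i j, id) \<in> carrier (ZSym n)" for m using assms by simp
  show ?thesis
  proof (cases "k < 0")
    case True
    then show ?thesis using ZSym_inv[OF c[of "nat (- k)"]] by (simp add: int_pow_def2 nat)
  qed (simp add: int_pow_def2 nat)
qed

lemma VBQ_model_lamQ:
  assumes n: "n \<ge> 2" and \<Phi>: "\<forall>x\<in>carrier (VB n). \<Phi> (to_VBQ n x) = VB_model n x"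
    and ij: "(i, j) \<in> off_diag n"
  shows "\<Phi> (lamQ n i j) = (unit_vec i j, id)"
  using VB_model_is_lam[OF n is_lam_lam[OF n ij]] \<Phi> is_lam_closed[OF n is_lam_lam[OF n ij]]
  by (simp add: lamQ_def)

text \<open>Stated for products over subsets of \<open>off_diag n\<close> so that one factor at a time can be split off.\<close>

lemma VBQ_model_lam_prod:
  assumes n: "n \<ge> 2" and \<Phi>: "\<Phi> \<in> hom (VBQ n) (ZSym n)"
      "\<forall>x\<in>carrier (VB n). \<Phi> (to_VBQ n x) = VB_model n x"
    and S: "S \<subseteq> off_diag n"
  shows "\<Phi> (\<Otimes>\<^bsub>VPQ n\<^esub>p\<in>S. lamQ n (fst p) (snd p) [^]\<^bsub>VPQ n\<^esub> e (fst p) (snd p))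
    = (\<lambda>i j. if (i, j) \<in> S then e i j else 0, id)"
  using finite_subset[OF S finite_off_diag] S
proof (induction S rule: finite_induct)
  case empty
  then show ?case using hom_one[OF \<Phi>(1) group_VBQ group_ZSym] by (simp add: VPQ_simps id_def)
next
  case (insert x S)
  obtain i j where x: "x = (i, j)" by force
  have ij: "(i, j) \<in> off_diag n" using insert.prems x by simp
  let ?P = "\<Otimes>\<^bsub>VPQ n\<^esub>p\<in>S. lamQ n (fst p) (snd p) [^]\<^bsub>VPQ n\<^esub> e (fst p) (snd p)"
  have Pc: "?P \<in> carrier (VPQ n)"
    by (rule VPQ.finprod_closed) (use insert.prems lam_pow_closed[OF n] in auto)
  have lc: "lamQ n i j [^]\<^bsub>VPQ n\<^esub> e i j \<in> carrier (VPQ n)" using lamQ_closed[OF n ij] by simp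
  have lV: "lamQ n i j \<in> carrier (VBQ n)"
    using lamQ_closed[OF n ij] subgroup.subset[OF VPQ_subgroup] by blast
  have "(\<Otimes>\<^bsub>VPQ n\<^esub>p\<in>insert x S. lamQ n (fst p) (snd p) [^]\<^bsub>VPQ n\<^esub> e (fst p) (snd p))
    = lamQ n i j [^]\<^bsub>VPQ n\<^esub> e i j \<otimes>\<^bsub>VBQ n\<^esub> ?P"
    using insert.hyps insert.prems lc lam_pow_closed[OF n]
    by (subst VPQ.finprod_insert) (auto simp: x VPQ_simps(2))
  also have "\<Phi> \<dots> = \<Phi> (lamQ n i j [^]\<^bsub>VPQ n\<^esub> e i j) \<otimes>\<^bsub>ZSym n\<^esub> \<Phi> ?P"
    by (rule hom_mult[OF \<Phi>(1)]) (use lc Pc subgroup.subset[OF VPQ_subgroup] in blast)+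
  also have "\<Phi> (lamQ n i j [^]\<^bsub>VPQ n\<^esub> e i j) = (\<lambda>a b. e i j * unit_vec i j a b, id)"
    unfolding VPQ_int_pow[OF lamQ_closed[OF n ij]]
    using hom_int_pow[OF \<Phi>(1) lV group_VBQ group_ZSym] ZSym_int_pow[OF unit_vec_closed[OF ij]]
    by (simp add: VBQ_model_lamQ[OF n \<Phi>(2) ij])
  also have "\<Phi> ?P = (\<lambda>i j. if (i, j) \<in> S then e i j else 0, id)"
    by (rule insert.IH) (use insert.prems in simp)
  also have "(\<lambda>a b. e i j * unit_vec i j a b, id) \<otimes>\<^bsub>ZSym n\<^esub> (\<lambda>i j. if (i, j) \<in> S then e i j else 0, id)
    = (\<lambda>a b. e i j * unit_vec i j a b + (if (a, b) \<in> S then e a b else 0), id)"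
    by (simp cong: if_cong)
  finally have "\<Phi> (\<Otimes>\<^bsub>VPQ n\<^esub>p\<in>insert x S. lamQ n (fst p) (snd p) [^]\<^bsub>VPQ n\<^esub> e (fst p) (snd p))
    = (\<lambda>a b. e i j * unit_vec i j a b + (if (a, b) \<in> S then e a b else 0), id)" .
  moreover have "e i j * unit_vec i j a b + (if (a, b) \<in> S then e a b else 0)
    = (if (a, b) \<in> insert x S then e a b else 0)" for a b
    using insert.hyps(2) by (cases "(a, b) = x") (auto simp: x unit_vec_def)
  ultimately show ?case by (simp only:)
qed

lemma VBQ_model_ZSym_to_VBQ:
  assumes n: "n \<ge> 2" and \<Phi>: "\<Phi> \<in> hom (VBQ n) (ZSym n)"
      "\<forall>x\<in>carrier (VB n). \<Phi> (to_VBQ n x) = VB_model n x"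
    and x: "x \<in> carrier (ZSym n)"
  shows "\<Phi> (ZSym_to_VBQ n x) = x"
proof -
  obtain e p where ep: "x = (e, p)" by force
  have p: "p permutes {1..n}" using x ep by simp
  have "\<Phi> (ZSym_to_VBQ n x) = \<Phi> (lam_prod n e) \<otimes>\<^bsub>ZSym n\<^esub> \<Phi> (perm_section n p)"
    unfolding ZSym_to_VBQ_def ep fst_conv snd_conv
    by (rule hom_mult[OF \<Phi>(1) lam_prod_closed_VBQ[OF n] perm_section_closed[OF p]])
  also have "\<Phi> (perm_section n p) = (\<lambda>i j. 0, p)"
    using \<Phi>(2) VB.lift_closed[OF p] by (simp add: perm_section_eq[OF p] VB_model_lift[OF p])
  also have "\<Phi> (lam_prod n e) = (\<lambda>i j. if (i, j) \<in> off_diag n then e i j else 0, id)"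
    unfolding lam_prod_def by (rule VBQ_model_lam_prod[OF n \<Phi> order.refl])
  also have "\<dots> = (e, id)" using x ep by (auto simp: fun_eq_iff)
  finally show ?thesis by (simp add: ep)
qed

text \<open>The homomorphism induced on the quotient by \<open>VB_model n\<close> is a left inverse.\<close>

lemma ZSym_to_VBQ_inj:
  assumes "n \<ge> 2"
  shows "inj_on (ZSym_to_VBQ n) (carrier (ZSym n))"
proof -
  obtain \<Phi> where "\<Phi> \<in> hom (VBQ n) (ZSym n)" "\<forall>x\<in>carrier (VB n). \<Phi> (to_VBQ n x) = VB_model n x"
    using VBQ_model_ex by blast
  then show ?thesis by (intro inj_on_inverseI) (rule VBQ_model_ZSym_to_VBQ[OF assms])
qed

lemma lamQ_inj:
  assumes n: "n \<ge> 2" and "(i, j) \<in> off_diag n" "(k, l) \<in> off_diag n" "lamQ n i j = lamQ n k l"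
  shows "i = k \<and> j = l"
proof -
  have "unit_vec i j = unit_vec k l"
    using VBQ_model_ex[of n] VBQ_model_lamQ[OF n] assms by (metis prod.inject)
  then have "unit_vec i j i j = unit_vec k l i j" by simp
  then show ?thesis by (auto simp: unit_vec_def split: if_splits)
qed


section \<open>Orders and orbit sums\<close>

lemma (in group_hom) ord_inj_image:
  assumes "inj_on h (carrier G)" "x \<in> carrier G"
  shows "H.ord (h x) = G.ord x"
proof -
  have "h x [^]\<^bsub>H\<^esub> k = \<one>\<^bsub>H\<^esub> \<longleftrightarrow> x [^] k = \<one>" for k :: nat
    using inj_on_eq_iff[OF assms(1), of "x [^] k" \<one>] assms(2) by (simp add: hom_nat_pow)
  then show ?thesis using assms(2) by (simp add: H.ord_unique G.pow_eq_id)
qed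

lemma Sym_nat_pow: "p [^]\<^bsub>Sym n\<^esub> (k::nat) = p ^^ k"
  by (induction k) simp_all

lemma ZSym_nat_pow:
  "(v, p) [^]\<^bsub>ZSym n\<^esub> (k::nat) = (\<lambda>i j. \<Sum>m<k. v ((p ^^ m) i) ((p ^^ m) j), p ^^ k)"
  by (induction k) (auto simp: fun_eq_iff)

lemma funpow_permutes: "p permutes S \<Longrightarrow> (p ^^ m) permutes S"
  by (induction m) (auto simp: permutes_id permutes_compose simp del: o_apply)

text \<open>The order is always a multiple of \<open>t\<close>, because the projection to \<open>Sym n\<close> has order \<open>t\<close>.  It equals
  \<open>t\<close> exactly when the \<open>t\<close>-th power, a vector of sums along the powers of \<open>p\<close>, vanishes.\<close>

lemma ord_ZSym_eq_iff:
  assumes vp: "(v, p) \<in> carrier (ZSym n)"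
  defines "t \<equiv> group.ord (Sym n) p"
  shows "group.ord (ZSym n) (v, p) = t \<longleftrightarrow>
    (\<forall>(i, j)\<in>off_diag n. (\<Sum>m<t. v ((p ^^ m) i) ((p ^^ m) j)) = 0)"
proof -
  have p: "p permutes {1..n}" "p \<in> carrier (Sym n)" using vp by auto
  have pt: "p ^^ t = id"
    using group.pow_ord_eq_1[OF group_Sym p(2)] by (simp add: t_def Sym_nat_pow)
  have "snd ((v, p) [^]\<^bsub>ZSym n\<^esub> group.ord (ZSym n) (v, p)) = id"
    by (simp add: group.pow_ord_eq_1[OF group_ZSym vp])
  then have "p [^]\<^bsub>Sym n\<^esub> group.ord (ZSym n) (v, p) = \<one>\<^bsub>Sym n\<^esub>"
    by (simp add: ZSym_nat_pow Sym_nat_pow)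
  then have dvd: "t dvd group.ord (ZSym n) (v, p)"
    unfolding t_def by (simp only: group.pow_eq_id[OF group_Sym p(2)])
  have "group.ord (ZSym n) (v, p) = t \<longleftrightarrow> group.ord (ZSym n) (v, p) dvd t"
    using dvd by (auto intro: dvd_antisym)
  also have "\<dots> \<longleftrightarrow> (v, p) [^]\<^bsub>ZSym n\<^esub> t = \<one>\<^bsub>ZSym n\<^esub>"
    by (simp only: group.pow_eq_id[OF group_ZSym vp])
  also have "\<dots> \<longleftrightarrow> (\<forall>i j. (\<Sum>m<t. v ((p ^^ m) i) ((p ^^ m) j)) = 0)"
    using pt by (simp add: ZSym_nat_pow fun_eq_iff)
  also have "\<dots> \<longleftrightarrow> (\<forall>(i, j)\<in>off_diag n. (\<Sum>m<t. v ((p ^^ m) i) ((p ^^ m) j)) = 0)"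
  proof -
    have "(\<Sum>m<t. v ((p ^^ m) i) ((p ^^ m) j)) = 0" if "(i, j) \<notin> off_diag n" for i j
      using vp off_diag_permutes[OF funpow_permutes[OF p(1)]] that by simp
    then show ?thesis by blast
  qed
  finally show ?thesis .
qed

lemma period_sum_shift:
  fixes g :: "'a \<Rightarrow> int"
  assumes "(f ^^ t) y = y"
  shows "(\<Sum>m<t. g ((f ^^ m) (f y))) = (\<Sum>m<t. g ((f ^^ m) y))"
proof -
  have "(\<Sum>m<t. g ((f ^^ m) (f y))) + g y = (\<Sum>m<Suc t. g ((f ^^ m) y))"
    unfolding sum.lessThan_Suc_shift by (simp add: funpow_swap1)
  then show ?thesis using assms by simp
qed

lemma funpow_period:
  assumes "(f ^^ t) x = x"
  shows "(f ^^ t) ((f ^^ m) x) = (f ^^ m) x"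
  using assms by (metis add.commute comp_apply funpow_add)

lemma period_sum_shift_funpow:
  fixes g :: "'a \<Rightarrow> int"
  assumes "(f ^^ t) x = x"
  shows "(\<Sum>m<t. g ((f ^^ m) ((f ^^ l) x))) = (\<Sum>m<t. g ((f ^^ m) x))"
proof (induction l)
  case (Suc l)
  then show ?case using period_sum_shift[of t f "(f ^^ l) x" g] funpow_period[OF assms, of l] by simp
qed simp

text \<open>The sum over a period \<open>t\<close> runs through the orbit \<open>S\<close> several times, and is a positive rational multiple of
  the sum over \<open>S\<close>.  The factor is found by summing \<open>g ((f ^^ m) y)\<close> over \<open>m < t\<close> and \<open>y \<in> S\<close> in two ways:
  for fixed \<open>y\<close> the sum over \<open>m\<close> does not depend on \<open>y\<close>, for fixed \<open>m\<close> the map \<open>f ^^ m\<close> permutes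
  \<open>S\<close>.  Hence \<open>card S\<close> times the first sum is \<open>t\<close> times the second.\<close>

lemma period_sum_eq_0_iff:
  fixes g :: "'a \<Rightarrow> int"
  assumes t: "0 < t" and x: "(f ^^ t) x = x"
  defines "S \<equiv> (\<lambda>m. (f ^^ m) x) ` {..<t}"
  shows "(\<Sum>m<t. g ((f ^^ m) x)) = 0 \<longleftrightarrow> (\<Sum>y\<in>S. g y) = 0"
proof -
  have fin: "finite S" and x_in: "x \<in> S" using t by (auto simp: S_def intro: image_eqI[of _ _ 0])
  have "f y \<in> S" if "y \<in> S" for y
  proof -
    obtain m where m: "m < t" "y = (f ^^ m) x" using \<open>y \<in> S\<close> by (auto simp: S_def)
    show ?thesis
    proof (cases "Suc m = t")
      case True
      then have "f y = x" using x m by auto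
      then show ?thesis using x_in by simp
    next
      case False
      then have "f y = (f ^^ Suc m) x" "Suc m < t" using m by auto
      then show ?thesis unfolding S_def by blast
    qed
  qed
  moreover have "inj_on f S"
  proof (rule inj_onI)
    fix y z assume yz: "y \<in> S" "z \<in> S" "f y = f z"
    obtain s where s: "t = Suc s" using t by (cases t) auto
    have "(f ^^ t) y = (f ^^ t) z" using yz(3) unfolding s by (simp only: funpow_Suc_right comp_apply)
    then show "y = z" using yz funpow_period[OF x] by (auto simp: S_def)
  qed
  ultimately have "bij_betw f S S"
    using fin by (simp add: bij_betw_def endo_inj_surj image_subset_iff)
  then have bij: "bij_betw (f ^^ m) S S" for m by (rule bij_betw_funpow)
  have "(\<Sum>y\<in>S. \<Sum>m<t. g ((f ^^ m) y)) = (\<Sum>y\<in>S. \<Sum>m<t. g ((f ^^ m) x))"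
    by (rule sum.cong[OF refl]) (use period_sum_shift_funpow[OF x, of g] in \<open>auto simp: S_def\<close>)
  then have "int (card S) * (\<Sum>m<t. g ((f ^^ m) x)) = (\<Sum>y\<in>S. \<Sum>m<t. g ((f ^^ m) y))" by simp
  also have "\<dots> = (\<Sum>m<t. \<Sum>y\<in>S. g ((f ^^ m) y))" by (rule sum.swap)
  also have "\<dots> = (\<Sum>m<t. \<Sum>y\<in>S. g y)"
    by (intro sum.cong refl sum.reindex_bij_betw bij)
  also have "\<dots> = int t * (\<Sum>y\<in>S. g y)" by simp
  finally have "int (card S) * (\<Sum>m<t. g ((f ^^ m) x)) = int t * (\<Sum>y\<in>S. g y)" .
  moreover have "card S \<noteq> 0" using fin x_in by auto
  ultimately show ?thesis using t by (metis mult_eq_0_iff of_nat_eq_0_iff less_irrefl)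
qed

lemma Sym_int_pow_eq_funpow:
  assumes p: "p permutes {1..n}"
  obtains m where "m < group.ord (Sym n) p" "p [^]\<^bsub>Sym n\<^esub> (k::int) = p ^^ m"
proof -
  define t where "t = group.ord (Sym n) p"
  have pc: "p \<in> carrier (Sym n)" using p by simp
  have "finite (carrier (Sym n))" by (simp add: finite_permutations)
  then have t: "t \<ge> 1" unfolding t_def by (rule group.ord_ge_1[OF group_Sym _ pc])
  define m where "m = nat (k mod int t)"
  have m: "int m = k mod int t" using t by (simp add: m_def)
  then have "p [^]\<^bsub>Sym n\<^esub> k = p [^]\<^bsub>Sym n\<^esub> int m"
    unfolding group.int_pow_eq[OF group_Sym pc] t_def[symmetric] by (simp add: mod_eq_dvd_iff[symmetric])
  moreover have "int m < int t" using m t by simp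
  ultimately show ?thesis using that[of m] by (simp add: int_pow_int Sym_nat_pow t_def)
qed

lemma map_prod_funpow:
  fixes f :: "'a \<Rightarrow> 'a" and g :: "'b \<Rightarrow> 'b"
  shows "(map_prod f g ^^ m) (i, j) = ((f ^^ m) i, (g ^^ m) j)"
  by (induction m) auto

lemma lam_orbit_eq:
  assumes p: "p permutes {1..n}"
  shows "lam_orbit n (inv\<^bsub>Sym n\<^esub> p) i j
    = (\<lambda>m. lamQ n ((p ^^ m) i) ((p ^^ m) j)) ` {..<group.ord (Sym n) p}" (is "_ = ?R")
proof -
  have pc: "p \<in> carrier (Sym n)" using p by simp
  have inv: "(inv\<^bsub>Sym n\<^esub> p) [^]\<^bsub>Sym n\<^esub> k = p [^]\<^bsub>Sym n\<^esub> (- k)" for k :: int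
    using group.int_pow_inv[OF group_Sym pc] group.int_pow_neg[OF group_Sym pc] by simp
  show ?thesis
  proof (intro equalityI subsetI)
    fix z assume "z \<in> lam_orbit n (inv\<^bsub>Sym n\<^esub> p) i j"
    then obtain k :: int where z: "z = lamQ n ((p [^]\<^bsub>Sym n\<^esub> (- k)) i) ((p [^]\<^bsub>Sym n\<^esub> (- k)) j)"
      by (auto simp: lam_orbit_def inv)
    obtain m where "m < group.ord (Sym n) p" "p [^]\<^bsub>Sym n\<^esub> (- k) = p ^^ m"
      by (rule Sym_int_pow_eq_funpow[OF p])
    then show "z \<in> ?R" unfolding z by simp
  next
    fix z assume "z \<in> ?R"
    then obtain m where z: "z = lamQ n ((p ^^ m) i) ((p ^^ m) j)" by auto
    have "p ^^ m = (inv\<^bsub>Sym n\<^esub> p) [^]\<^bsub>Sym n\<^esub> (- int m)"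
      unfolding inv by (simp add: int_pow_int Sym_nat_pow)
    then show "z \<in> lam_orbit n (inv\<^bsub>Sym n\<^esub> p) i j"
      unfolding lam_orbit_def z by (intro CollectI exI[of _ "- int m"]) simp
  qed
qed

text \<open>Since distinct pairs give distinct \<open>\<lambda>\<^bsub>i,j\<^esub>\<close>, the orbit of \<open>\<lambda>\<^bsub>i,j\<^esub>\<close> is the orbit of the pair
  \<open>(i, j)\<close>; since \<open>p\<close> has finite order, forward powers of \<open>p\<close> reach all of it.\<close>

lemma lam_orbit_pairs:
  assumes n: "n \<ge> 2" and p: "p permutes {1..n}" and ij: "(i, j) \<in> off_diag n"
  shows "{(k, l) \<in> off_diag n. lamQ n k l \<in> lam_orbit n (inv\<^bsub>Sym n\<^esub> p) i j}
    = (\<lambda>m. (map_prod p p ^^ m) (i, j)) ` {..<group.ord (Sym n) p}"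
proof (intro equalityI subsetI)
  have mem: "((p ^^ m) i, (p ^^ m) j) \<in> off_diag n" for m
    using off_diag_permutes[OF funpow_permutes[OF p]] ij by simp
  fix x
  assume "x \<in> {(k, l) \<in> off_diag n. lamQ n k l \<in> lam_orbit n (inv\<^bsub>Sym n\<^esub> p) i j}"
  then obtain k l m where x: "x = (k, l)" "(k, l) \<in> off_diag n" and m: "m < group.ord (Sym n) p"
    and "lamQ n k l = lamQ n ((p ^^ m) i) ((p ^^ m) j)"
    unfolding lam_orbit_eq[OF p] by blast
  then have "x = (map_prod p p ^^ m) (i, j)"
    using lamQ_inj[OF n x(2) mem] by (simp add: map_prod_funpow)
  then show "x \<in> (\<lambda>m. (map_prod p p ^^ m) (i, j)) ` {..<group.ord (Sym n) p}" using m by blast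
next
  fix x assume "x \<in> (\<lambda>m. (map_prod p p ^^ m) (i, j)) ` {..<group.ord (Sym n) p}"
  then show "x \<in> {(k, l) \<in> off_diag n. lamQ n k l \<in> lam_orbit n (inv\<^bsub>Sym n\<^esub> p) i j}"
    using off_diag_permutes[OF funpow_permutes[OF p]] ij
    by (auto simp: lam_orbit_eq[OF p] map_prod_funpow)
qed

text \<open>A conjugating element \<open>g\<close> is an integer power of the section of \<open>p\<close>, hence itself the section of a power
  \<open>q\<close> of \<open>p\<close>, and it moves \<open>\<lambda>\<^bsub>i,j\<^esub>\<close> by \<open>q\<^sup>-\<^sup>1\<close>, which is again a nonnegative power of \<open>p\<close>.\<close>

lemma lam_transversal_meets:
  assumes n: "n \<ge> 2" and p: "p permutes {1..n}" and ij: "(i, j) \<in> off_diag n"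
    and T: "lam_transversal n (perm_section n p) T"
  obtains m where "lamQ n ((p ^^ m) i) ((p ^^ m) j) \<in> T"
proof -
  let ?s = "perm_section n p" and ?x = "lamQ n i j"
  have pc: "p \<in> carrier (Sym n)" using p by simp
  have x: "?x \<in> Lams n" using ij by (auto simp: Lams_def)
  define G where "G = (VBQ n)\<lparr>carrier := generate (VBQ n) {?s}\<rparr>"
  have "orbit G (conj_on_Lams n) ?x \<in> orbits G (Lams n) (conj_on_Lams n)"
    using x by (auto simp: orbits_def)
  then obtain y where y: "y \<in> T" "y \<in> orbit G (conj_on_Lams n) ?x"
    using T unfolding lam_transversal_def G_def by blast
  then obtain g where g: "g \<in> generate (VBQ n) {?s}" "y = conj_on_Lams n g ?x"
    by (auto simp: orbit_def G_def)
  obtain k :: int where k: "g = ?s [^]\<^bsub>VBQ n\<^esub> k"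
    using g(1) group.generate_pow[OF group_VBQ perm_section_closed[OF p]] by auto
  define q where "q = p [^]\<^bsub>Sym n\<^esub> k"
  have qc: "q \<in> carrier (Sym n)" unfolding q_def by (rule group.int_pow_closed[OF group_Sym pc])
  then have q: "q permutes {1..n}" by simp
  have sec: "perm_section n \<in> hom (Sym n) (VBQ n)"
    by (rule homI) (simp_all add: perm_section_closed perm_section_mult)
  have gq: "g = perm_section n q"
    unfolding k q_def using hom_int_pow[OF sec pc group_Sym group_VBQ] by simp
  obtain m where m: "p [^]\<^bsub>Sym n\<^esub> (- k) = p ^^ m" by (rule Sym_int_pow_eq_funpow[OF p])
  have "p ^^ m = inv\<^bsub>Sym n\<^esub> q" unfolding m[symmetric] q_def by (rule group.int_pow_neg[OF group_Sym pc])
  then have pm: "p ^^ m = inv_into UNIV q" using inv_Sym[OF q] by simp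
  have "(inv_into UNIV q i, inv_into UNIV q j) \<in> off_diag n"
    using off_diag_permutes[OF permutes_inv[OF q]] ij by simp
  from perm_section_conj_lamQ[OF n q this]
  have "y = lamQ n ((p ^^ m) i) ((p ^^ m) j)"
    using x by (simp add: g(2) conj_on_Lams_def gq pm permutes_inverses(1)[OF q])
  then show ?thesis using that y(1) by blast
qed

theorem theorem3p6:
  fixes n t :: nat
    and \<sigma> \<theta> :: "nat \<Rightarrow> nat"
    and T :: "vb_gen word set set set"
    and a :: "nat \<Rightarrow> nat \<Rightarrow> int"
  assumes "n \<ge> 2"
    and "\<sigma> \<in> carrier (Sym n)"
    and "group.ord (Sym n) \<sigma> = t"
    and "\<theta> = inv\<^bsub>Sym n\<^esub> (pi_bar n (perm_section n \<sigma>))"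
    and "lam_transversal n (perm_section n \<sigma>) T"
  shows "group.ord (VBQ n)
           ((\<Otimes>\<^bsub>VPQ n\<^esub>p\<in>off_diag n. lamQ n (fst p) (snd p) [^]\<^bsub>VPQ n\<^esub> a (fst p) (snd p))
              \<otimes>\<^bsub>VBQ n\<^esub> perm_section n \<sigma>) = t
    \<longleftrightarrow> (\<forall>(i, j) \<in> off_diag n. lamQ n i j \<in> T \<longrightarrow>
          (\<Sum>(i1, j1) \<in> {(i1, j1) \<in> off_diag n. lamQ n i1 j1 \<in> lam_orbit n \<theta> i j}. a i1 j1) = 0)"
proof -
  have p: "\<sigma> permutes {1..n}" using assms(2) by simp
  have \<theta>: "\<theta> = inv\<^bsub>Sym n\<^esub> \<sigma>" using assms(4) pi_bar_perm_section[OF p] by simp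
  have "finite (carrier (Sym n))" by (simp add: finite_permutations)
  then have t: "0 < t" using group.ord_ge_1[OF group_Sym _ assms(2)] assms(3) by simp
  have pt: "\<sigma> ^^ t = id"
    using group.pow_ord_eq_1[OF group_Sym assms(2)] assms(3) by (simp add: Sym_nat_pow)
  define f where "f = map_prod \<sigma> \<sigma>"
  define g where "g = case_prod a"
  \<comment> \<open>Only the values of \<open>a\<close> on \<open>off_diag n\<close> occur, and elements of \<open>ZSym n\<close> must vanish elsewhere.\<close>
  define v where "v i j = (if (i, j) \<in> off_diag n then a i j else 0)" for i j
  define Q where "Q x \<longleftrightarrow> (\<Sum>m<t. g ((f ^^ m) x)) = 0" for x
  have ft: "(f ^^ t) x = x" for x by (cases x) (simp add: f_def map_prod_funpow pt)
  have pow: "(\<sigma> ^^ m) permutes {1..n}" for m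
    by (rule funpow_permutes[OF p])
  have v: "(v, \<sigma>) \<in> carrier (ZSym n)" using p by (simp add: v_def)
  have prod: "(\<Otimes>\<^bsub>VPQ n\<^esub>p\<in>off_diag n. lamQ n (fst p) (snd p) [^]\<^bsub>VPQ n\<^esub> a (fst p) (snd p)) = lam_prod n v"
    unfolding lam_prod_def
    by (rule VPQ.finprod_cong'[OF refl]) (auto simp: v_def lamQ_closed[OF assms(1)])
  have hom: "group_hom (ZSym n) (VBQ n) (ZSym_to_VBQ n)"
    by (intro group_hom.intro group_hom_axioms.intro group_ZSym group_VBQ ZSym_to_VBQ_hom assms(1))
  have "group.ord (VBQ n) (lam_prod n v \<otimes>\<^bsub>VBQ n\<^esub> perm_section n \<sigma>) = group.ord (ZSym n) (v, \<sigma>)"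
    using group_hom.ord_inj_image[OF hom ZSym_to_VBQ_inj[OF assms(1)] v] by (simp add: ZSym_to_VBQ_def)
  also have "\<dots> = t \<longleftrightarrow> (\<forall>(i, j)\<in>off_diag n. (\<Sum>m<t. v ((\<sigma> ^^ m) i) ((\<sigma> ^^ m) j)) = 0)"
    using ord_ZSym_eq_iff[OF v] assms(3) by simp
  also have "\<dots> \<longleftrightarrow> (\<forall>x\<in>off_diag n. Q x)"
    by (auto simp: Q_def g_def f_def map_prod_funpow v_def off_diag_permutes[OF pow] Ball_def)
  \<comment> \<open>The sum over a period is constant on orbits, and every orbit meets \<open>T\<close>.\<close>
  also have "\<dots> \<longleftrightarrow> (\<forall>(i, j)\<in>off_diag n. lamQ n i j \<in> T \<longrightarrow> Q (i, j))"
  proof (intro iffI ballI)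
    fix x assume T: "\<forall>(i, j)\<in>off_diag n. lamQ n i j \<in> T \<longrightarrow> Q (i, j)" and x: "x \<in> off_diag n"
    obtain i j where ij: "x = (i, j)" by force
    obtain m where m: "lamQ n ((\<sigma> ^^ m) i) ((\<sigma> ^^ m) j) \<in> T"
      using lam_transversal_meets[OF assms(1) p _ assms(5)] x ij by blast
    have "((\<sigma> ^^ m) i, (\<sigma> ^^ m) j) \<in> off_diag n" using off_diag_permutes[OF pow] x ij by simp
    with T m have "Q ((f ^^ m) x)" by (auto simp: ij f_def map_prod_funpow)
    then show "Q x" unfolding Q_def using period_sum_shift_funpow[of t f x g m] ft by simp
  qed auto
  also have "\<dots> \<longleftrightarrow> (\<forall>(i, j) \<in> off_diag n. lamQ n i j \<in> T \<longrightarrow>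
          (\<Sum>(i1, j1) \<in> {(i1, j1) \<in> off_diag n. lamQ n i1 j1 \<in> lam_orbit n \<theta> i j}. a i1 j1) = 0)"
  proof -
    have "Q (i, j) \<longleftrightarrow> (\<Sum>(i1, j1) \<in> {(i1, j1) \<in> off_diag n. lamQ n i1 j1 \<in> lam_orbit n \<theta> i j}. a i1 j1) = 0"
      if "(i, j) \<in> off_diag n" for i j
      unfolding Q_def \<theta> lam_orbit_pairs[OF assms(1) p that] assms(3) g_def[symmetric] f_def[symmetric]
      by (rule period_sum_eq_0_iff[OF t ft])
    then show ?thesis by (intro ball_cong refl) auto
  qed
  finally show ?thesis unfolding prod .
qed

end
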